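(* Let $d\in\mathbb N$, $p>2$, $\varepsilon_0\in(0,1)$, $x\in\mathbb R^d$, and let $\varphi\in C^2(B_{\varepsilon_0}(x))$ be such that $\nabla\varphi(x)\neq 0$. Let $m(\varepsilon)=\varepsilon^{\frac{2}{2+\alpha}}$ and $M(\varepsilon)=\varepsilon^{-\frac{2}{2-\alpha}}$, and let $\mathcal A^{\pm}_\varepsilon$ be the corresponding averaging operators (see context). Then the following assertions hold. (a) There exists $\overline\varepsilon\in(0,\varepsilon_0)$ such that, for all $\varepsilon\in(0,\overline\varepsilon)$, the following quantity is well defined: $$\mathcal A_\varepsilon[\varphi](x):=\begin{cases}\mathcal A_\varepsilon^+[\varphi](x) & \text{if } \Delta_p\varphi(x)\ge 0,\\ \mathcal A_\varepsilon^-[\varphi](x) & \text{if } \Delta_p\varphi(x)<0.\end{cases}$$ (b) If $\Delta_p\varphi(x)\ne 0$, then $$\mathcal A_\varepsilon[\varphi](x)=\varphi(x)+\varepsilon^2J_p(\Delta_p\varphi(x))+o(\varepsilon^2)\quad\text{as }\varepsilon\to0^+.$$ (c) There are positive constants $K_1,K_2$ depending only on $p$ and $d$ such that, if additionally $\varphi\in C^3(B_{\varepsilon_0}(x))$ (here $\Delta_p\varphi(x)=0$ is allowed), then $\overline\varepsilon\in(0,\varepsilon_0)$ can be taken such that, for all $\varepsilon\in(0,\overline\varepsilon)$, $$\mathcal A_\varepsilon[\varphi](x)=\varphi(x)+\varepsilon^2J_p(\Delta_p\varphi(x))+\varepsilon^2E(\varphi,\varepsilon),$$ with $$|E(\varphi,\varepsilon)|\le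 K_1\|D^2\varphi\|_{L^\infty(B_{\overline\varepsilon}(x))}\,\varepsilon^{\frac{2(p-2)}{p}}+K_2\Big(\|\nabla\varphi\|_{L^\infty(B_{\overline\varepsilon}(x))}+\|D^3\varphi\|_{L^\infty(B_{\overline\varepsilon}(x))}+\frac{|D^2\varphi(x)|^2}{|\nabla\varphi(x)|}\Big)\varepsilon^{\frac{2}{3p-4}}.$$
   Context: Constants: $\alpha=\frac{p-2}{p-1}$, $\beta=\frac{p-2}{p+d}$, $\gamma=\sqrt{2(p+d)}$. $B_r(x)$ is the open ball of radius $r$ centred at $x$. The $p$-Laplacian is $\Delta_p\varphi=\nabla\cdot(|\nabla\varphi|^{p-2}\nabla\varphi)$; where $\nabla\varphi\ne0$ it equals $|\nabla\varphi|^{p-2}\big((p-2)\langle D^2\varphi\frac{\nabla\varphi}{|\nabla\varphi|},\frac{\nabla\varphi}{|\nabla\varphi|}\rangle+\Delta\varphi\big)$. The signed power is $J_p(\xi)=\xi^{\frac1{p-1}}$ for $\xi\ge0$ and $J_p(\xi)=-(-\xi)^{\frac1{p-1}}$ for $\xi\le 0$. For $r>0$ and a bounded Borel function $\varphi$ on a ball around $x$ containing $B_{\gamma r}(x)$, $$\mathcal M_r[\varphi](x)=\beta\Big(\tfrac12\sup_{B_{\gamma r}(x)}\varphi+\tfrac12\inf_{B_{\gamma r}(x)}\varphi\Big)+(1-\beta)\frac{1}{|B_{\gamma r}(x)|}\int_{B_{\gamma r}(x)}\varphi(y)\,dy .$$ For $\varepsilon>0$, $$\mathcal A^+_\varepsilon[\varphi](x)=\inf_{c\in[m(\varepsilon),M(\varepsilon)]}\Big\{\alpha\sup_{B_{\varepsilon^2c^{1-\alpha}}(x)}\varphi+(1-\alpha)\mathcal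 M_{\varepsilon c^{-\alpha/2}}[\varphi](x)\Big\},$$ $$\mathcal A^-_\varepsilon[\varphi](x)=\sup_{c\in[m(\varepsilon),M(\varepsilon)]}\Big\{\alpha\inf_{B_{\varepsilon^2c^{1-\alpha}}(x)}\varphi+(1-\alpha)\mathcal M_{\varepsilon c^{-\alpha/2}}[\varphi](x)\Big\}.$$ "Well defined" means that all the balls involved are contained in the domain $B_{\varepsilon_0}(x)$ of $\varphi$ and all infima, suprema and integrals involved are finite. *)

theory Defs
  imports "HOL-Analysis.Analysis" "HOL-Library.Landau_Symbols"
    "HOL-Probability.Essential_Supremum"
begin

section \<open>Differential calculus on subsets of Euclidean space\<close>

definition partial_deriv :: "'n::finite \<Rightarrow> (real^'n \<Rightarrow> real) \<Rightarrow> real^'n \<Rightarrow> real" where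
  "partial_deriv i f y = frechet_derivative f (at y) (axis i 1)"

text \<open>The class $C^k(S)$. This is meant for open \<open>S\<close>, so that only the values of \<open>f\<close> on \<open>S\<close>
  matter. Differentiability is required explicitly because \<^const>\<open>frechet_derivative\<close> is
  unspecified at points where \<open>f\<close> is not differentiable.\<close>

primrec C_on :: "nat \<Rightarrow> (real^'n::finite) set \<Rightarrow> (real^'n \<Rightarrow> real) \<Rightarrow> bool" where
  "C_on 0 S f \<longleftrightarrow> continuous_on S f"
| "C_on (Suc k) S f \<longleftrightarrow>
     (\<forall>y\<in>S. f differentiable (at y)) \<and> (\<forall>i. C_on k S (partial_deriv i f))"

definition gradient :: "(real^'n::finite \<Rightarrow> real) \<Rightarrow> real^'n \<Rightarrow> real^'n" where
  "gradient f y = (\<chi> i. partial_deriv i f y)"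

text \<open>On the iterated vector types below, \<^const>\<open>norm\<close> is the Euclidean (Frobenius) norm of the
  array of all partial derivatives of the given order.\<close>

definition hessian :: "(real^'n::finite \<Rightarrow> real) \<Rightarrow> real^'n \<Rightarrow> real^'n^'n" where
  "hessian f y = (\<chi> i j. partial_deriv i (partial_deriv j f) y)"

definition third_deriv :: "(real^'n::finite \<Rightarrow> real) \<Rightarrow> real^'n \<Rightarrow> real^'n^'n^'n" where
  "third_deriv f y = (\<chi> i j k. partial_deriv i (partial_deriv j (partial_deriv k f)) y)"

definition divergence :: "(real^'n::finite \<Rightarrow> real^'n) \<Rightarrow> real^'n \<Rightarrow> real" where
  "divergence F y = (\<Sum>i\<in>UNIV. partial_deriv i (\<lambda>z. F z $ i) y)"

definition p_laplacian :: "real \<Rightarrow> (real^'n::finite \<Rightarrow> real) \<Rightarrow> real^'n \<Rightarrow> real" where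
  "p_laplacian p f = divergence (\<lambda>y. norm (gradient f y) powr (p - 2) *\<^sub>R gradient f y)"

text \<open>The norm of \<open>L\<^sup>\<infinity>(S)\<close>, with values in $[0,\infty]$.\<close>

definition Linf_norm ::
    "'a::euclidean_space set \<Rightarrow> ('a \<Rightarrow> 'b::real_normed_vector) \<Rightarrow> ereal" where
  "Linf_norm S f = esssup (lebesgue_on S) (\<lambda>y. ereal (norm (f y)))"


section \<open>Constants and the signed power\<close>

definition alpha_const :: "real \<Rightarrow> real" where
  "alpha_const p = (p - 2) / (p - 1)"

definition beta_const :: "real \<Rightarrow> nat \<Rightarrow> real" where
  "beta_const p d = (p - 2) / (p + real d)"

definition gamma_const :: "real \<Rightarrow> nat \<Rightarrow> real" where
  "gamma_const p d = sqrt (2 * (p + real d))"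

definition J :: "real \<Rightarrow> real \<Rightarrow> real" where
  "J p \<xi> = (if \<xi> \<ge> 0 then \<xi> powr (1 / (p - 1)) else - ((- \<xi>) powr (1 / (p - 1))))"

definition m_eps :: "real \<Rightarrow> real \<Rightarrow> real" where
  "m_eps p \<epsilon> = \<epsilon> powr (2 / (2 + alpha_const p))"

definition M_eps :: "real \<Rightarrow> real \<Rightarrow> real" where
  "M_eps p \<epsilon> = \<epsilon> powr (- (2 / (2 - alpha_const p)))"


section \<open>Averaging operators\<close>

text \<open>Suprema, infima and integrals are those of \<^typ>\<open>real\<close>, hence meaningful only under the
  finiteness conditions collected in \<open>A_well_defined\<close> below.\<close>

definition mean_op :: "real \<Rightarrow> real \<Rightarrow> (real^'n::finite \<Rightarrow> real) \<Rightarrow> real^'n \<Rightarrow> real" where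
  "mean_op p r \<phi> x =
     (let B = ball x (gamma_const p CARD('n) * r); \<beta> = beta_const p CARD('n)
      in \<beta> * ((1/2) * (SUP y\<in>B. \<phi> y) + (1/2) * (INF y\<in>B. \<phi> y))
         + (1 - \<beta>) * ((1 / measure lborel B) * (LINT y:B|lborel. \<phi> y)))"

definition A_plus_body ::
    "real \<Rightarrow> real \<Rightarrow> (real^'n::finite \<Rightarrow> real) \<Rightarrow> real^'n \<Rightarrow> real \<Rightarrow> real" where
  "A_plus_body p \<epsilon> \<phi> x c =
     (let \<alpha> = alpha_const p
      in \<alpha> * (SUP y\<in>ball x (\<epsilon>\<^sup>2 * c powr (1 - \<alpha>)). \<phi> y)
         + (1 - \<alpha>) * mean_op p (\<epsilon> * c powr (- \<alpha> / 2)) \<phi> x)"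

definition A_minus_body ::
    "real \<Rightarrow> real \<Rightarrow> (real^'n::finite \<Rightarrow> real) \<Rightarrow> real^'n \<Rightarrow> real \<Rightarrow> real" where
  "A_minus_body p \<epsilon> \<phi> x c =
     (let \<alpha> = alpha_const p
      in \<alpha> * (INF y\<in>ball x (\<epsilon>\<^sup>2 * c powr (1 - \<alpha>)). \<phi> y)
         + (1 - \<alpha>) * mean_op p (\<epsilon> * c powr (- \<alpha> / 2)) \<phi> x)"

definition A_plus :: "real \<Rightarrow> real \<Rightarrow> (real^'n::finite \<Rightarrow> real) \<Rightarrow> real^'n \<Rightarrow> real" where
  "A_plus p \<epsilon> \<phi> x = (INF c\<in>{m_eps p \<epsilon>..M_eps p \<epsilon>}. A_plus_body p \<epsilon> \<phi> x c)"

definition A_minus :: "real \<Rightarrow> real \<Rightarrow> (real^'n::finite \<Rightarrow> real) \<Rightarrow> real^'n \<Rightarrow> real" where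
  "A_minus p \<epsilon> \<phi> x = (SUP c\<in>{m_eps p \<epsilon>..M_eps p \<epsilon>}. A_minus_body p \<epsilon> \<phi> x c)"

definition A_op :: "real \<Rightarrow> real \<Rightarrow> (real^'n::finite \<Rightarrow> real) \<Rightarrow> real^'n \<Rightarrow> real" where
  "A_op p \<epsilon> \<phi> x = (if p_laplacian p \<phi> x \<ge> 0 then A_plus p \<epsilon> \<phi> x else A_minus p \<epsilon> \<phi> x)"


section \<open>Well-definedness\<close>

text \<open>In the following definitions \<open>U\<close> is the domain of \<open>\<phi>\<close>. An infimum (supremum) is finite iff
  it is taken over a nonempty set that is bounded below (above).\<close>

definition mean_op_well_defined ::
    "real \<Rightarrow> (real^'n::finite) set \<Rightarrow> real \<Rightarrow> (real^'n \<Rightarrow> real) \<Rightarrow> real^'n \<Rightarrow> bool" where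
  "mean_op_well_defined p U r \<phi> x \<longleftrightarrow>
     (let B = ball x (gamma_const p CARD('n) * r)
      in B \<noteq> {} \<and> B \<subseteq> U \<and> bdd_above (\<phi> ` B) \<and> bdd_below (\<phi> ` B)
         \<and> set_integrable lborel B \<phi>)"

definition A_plus_well_defined ::
    "real \<Rightarrow> (real^'n::finite) set \<Rightarrow> real \<Rightarrow> (real^'n \<Rightarrow> real) \<Rightarrow> real^'n \<Rightarrow> bool" where
  "A_plus_well_defined p U \<epsilon> \<phi> x \<longleftrightarrow>
     (\<forall>c\<in>{m_eps p \<epsilon>..M_eps p \<epsilon>}.
        (let B = ball x (\<epsilon>\<^sup>2 * c powr (1 - alpha_const p))
         in B \<noteq> {} \<and> B \<subseteq> U \<and> bdd_above (\<phi> ` B))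
        \<and> mean_op_well_defined p U (\<epsilon> * c powr (- alpha_const p / 2)) \<phi> x)
     \<and> {m_eps p \<epsilon>..M_eps p \<epsilon>} \<noteq> {}
     \<and> bdd_below (A_plus_body p \<epsilon> \<phi> x ` {m_eps p \<epsilon>..M_eps p \<epsilon>})"

definition A_minus_well_defined ::
    "real \<Rightarrow> (real^'n::finite) set \<Rightarrow> real \<Rightarrow> (real^'n \<Rightarrow> real) \<Rightarrow> real^'n \<Rightarrow> bool" where
  "A_minus_well_defined p U \<epsilon> \<phi> x \<longleftrightarrow>
     (\<forall>c\<in>{m_eps p \<epsilon>..M_eps p \<epsilon>}.
        (let B = ball x (\<epsilon>\<^sup>2 * c powr (1 - alpha_const p))
         in B \<noteq> {} \<and> B \<subseteq> U \<and> bdd_below (\<phi> ` B))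
        \<and> mean_op_well_defined p U (\<epsilon> * c powr (- alpha_const p / 2)) \<phi> x)
     \<and> {m_eps p \<epsilon>..M_eps p \<epsilon>} \<noteq> {}
     \<and> bdd_above (A_minus_body p \<epsilon> \<phi> x ` {m_eps p \<epsilon>..M_eps p \<epsilon>})"

definition A_well_defined ::
    "real \<Rightarrow> (real^'n::finite) set \<Rightarrow> real \<Rightarrow> (real^'n \<Rightarrow> real) \<Rightarrow> real^'n \<Rightarrow> bool" where
  "A_well_defined p U \<epsilon> \<phi> x \<longleftrightarrow>
     (if p_laplacian p \<phi> x \<ge> 0 then A_plus_well_defined p U \<epsilon> \<phi> x
      else A_minus_well_defined p U \<epsilon> \<phi> x)"

end

theory Submission
  imports Defs
begin

text \<open>
  Let \<open>g\<close> and \<open>H\<close> be the gradient and the Hessian of \<open>\<phi>\<close> at \<open>x\<close>, and put \<open>G = |g|\<close>, \<open>n = g/G\<close>,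
  \<open>a = \<alpha>\<close> and \<open>L = (p - 2) \<langle>Hn, n\<rangle> + tr H\<close>, so that the p-Laplacian of \<open>\<phi>\<close> at \<open>x\<close> is \<open>G\<^sup>p\<^sup>-\<^sup>2 L\<close>
  (\<open>p_laplacian_eq\<close>). For a fixed parameter \<open>c\<close> the functional inside the infimum is, up to a small
  error,
  \<open>\<phi>(x) + \<epsilon>\<^sup>2 (a c\<^sup>1\<^sup>-\<^sup>a G + (1 - a) c\<^sup>-\<^sup>a L)\<close>: the supremum over the small ball sees the gradient,
  and the constants \<open>\<beta>\<close> and \<open>\<gamma>\<close> are tuned so that the mean-value operator sees exactly \<open>L\<close>. For
  \<open>L > 0\<close> the weighted inequality between arithmetic and geometric mean shows that the bracket is
  at least \<open>G\<^sup>a L\<^sup>1\<^sup>-\<^sup>a\<close>, with equality at \<open>c = L/G\<close>, and this number is the signed power of the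
  p-Laplacian (\<open>young_fun_ge\<close>, \<open>young_fun_argmin\<close>, \<open>J_eq\<close>). The optimal \<open>c\<close> is admissible for
  small \<open>\<epsilon>\<close> because the parameter range exhausts the positive half-line. For \<open>L = 0\<close> the infimum
  of the bracket over all \<open>c > 0\<close> is zero but is not attained; the left endpoint of the range leaves
  the value \<open>a G \<epsilon>\<^bsup>2/(3p-4)\<^esup>\<close>. The case \<open>L < 0\<close> is the case \<open>L > 0\<close> for \<open>-\<phi>\<close>.

  What has to be controlled is the error, uniformly in \<open>c\<close>. It is enough to know \<open>\<phi>\<close> through its
  second-order Taylor polynomial at \<open>x\<close> and a bound for the remainder (\<open>quadratic_approx\<close>), since
  every operator involved is monotone and commutes with adding constants. For the polynomial itself
  the mean over a ball is exact (\<open>integral_ball_quad_poly\<close>), and completing a square shows that its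
  extrema over a ball of radius \<open>R\<close> are those along the direction \<open>n\<close> up to \<open>R\<^sup>3 |H|\<^sup>2 / (2 G)\<close>
  (\<open>quad_poly_le\<close>). The endpoints of the parameter range turn powers of the two radii into the two
  powers of \<open>\<epsilon>\<close> in the error bound (\<open>radius_bounds\<close>).

  If \<open>\<phi>\<close> is of class \<open>C\<^sup>2\<close>, the remainder is at most \<open>\<eta> |h|\<^sup>2\<close> near \<open>x\<close>, with \<open>\<eta>\<close> as small as one
  likes. In the mean-value operator it is not small compared with \<open>\<epsilon>\<^sup>2\<close>, because the radius may be
  much larger than \<open>\<epsilon>\<close>; but it is proportional to \<open>c\<^sup>-\<^sup>a\<close>, like the term with \<open>L\<close>, and can
  therefore be absorbed by moving \<open>L\<close> to \<open>L \<plusminus> \<gamma>\<^sup>2 \<eta>\<close>. Continuity of the signed power then gives the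
  expansion with \<open>o(\<epsilon>\<^sup>2)\<close> (\<open>A_plus_asymptotics\<close>). If \<open>\<phi>\<close> is of class \<open>C\<^sup>3\<close>, the remainder is
  at most \<open>(|T| + G) |h|\<^sup>3\<close> near \<open>x\<close>, where \<open>T\<close> is the array of third derivatives at \<open>x\<close>, and this
  gives the rate (\<open>A_plus_rate\<close>). The balls in the mean-value operator may leave the ball on which
  the \<open>L\<^sup>\<infinity>\<close> norms are taken, so that the third derivatives on them are not bounded by these norms;
  bounding them by \<open>|T| + G\<close>, through continuity at \<open>x\<close>, avoids this. In the end only values at
  the centre \<open>x\<close> enter, and these are bounded by the essential suprema because the derivatives are
  continuous (\<open>norm_le_Linf_norm\<close>).
\<close>

section \<open>Extrema of a nearly quadratic function over a ball\<close>

text \<open>Contracting an array of derivatives with a vector, one index after another, costs a factor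
  \<open>|h|\<close> each time, because the norm of an iterated vector type is the Euclidean norm of all entries.\<close>

lemma norm_contraction_le:
  fixes X :: "('a::real_normed_vector)^'n::finite" and h :: "real^'n"
  shows "norm (\<Sum>i\<in>UNIV. h $ i *\<^sub>R X $ i) \<le> norm h * norm X"
proof -
  have "norm (\<Sum>i\<in>UNIV. h $ i *\<^sub>R X $ i) \<le> (\<Sum>i\<in>UNIV. \<bar>h $ i\<bar> * \<bar>norm (X $ i)\<bar>)"
    by (rule order_trans[OF norm_sum]) simp
  also have "\<dots> \<le> L2_set (\<lambda>i. h $ i) UNIV * L2_set (\<lambda>i. norm (X $ i)) UNIV"
    by (rule L2_set_mult_ineq)
  also have "\<dots> = norm h * norm X"
    by (simp add: norm_vec_def L2_set_def)
  finally show ?thesis .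
qed

lemma inner_matrix_le:
  fixes H :: "real^'n^'n::finite"
  shows "\<bar>h \<bullet> (H *v k)\<bar> \<le> norm H * norm h * norm k"
proof -
  have "h \<bullet> (H *v k) = (\<Sum>i\<in>UNIV. h $ i *\<^sub>R H $ i) \<bullet> k"
    by (simp add: inner_vec_def matrix_vector_mult_def inner_sum_left sum_distrib_left
          sum_distrib_right mult_ac) (rule sum.swap)
  also have "\<bar>\<dots>\<bar> \<le> norm (\<Sum>i\<in>UNIV. h $ i *\<^sub>R H $ i) * norm k"
    by (rule Cauchy_Schwarz_ineq2)
  also have "\<dots> \<le> norm h * norm H * norm k"
    by (intro mult_right_mono norm_contraction_le) simp
  finally show ?thesis by (simp add: mult_ac)
qed

definition quad_poly :: "real^'n::finite \<Rightarrow> real^'n^'n \<Rightarrow> real^'n \<Rightarrow> real" where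
  "quad_poly g H h = g \<bullet> h + 1/2 * (h \<bullet> (H *v h))"

definition dir_second_deriv :: "real^'n::finite \<Rightarrow> real^'n^'n \<Rightarrow> real" where
  "dir_second_deriv g H = sgn g \<bullet> (H *v sgn g)"

lemma matrix_vector_mult_minus: "(- H) *v h = - (H *v (h::real^'n::finite))"
  by (simp add: vec_eq_iff matrix_vector_mult_def sum_negf)

lemma quad_poly_minus: "quad_poly (- g) (- H) h = - quad_poly g H h"
  by (simp add: quad_poly_def matrix_vector_mult_minus)

lemma dir_second_deriv_minus: "dir_second_deriv (- g) (- H) = - dir_second_deriv g H"
proof -
  have "H *v (- sgn g) = - (H *v sgn g)"
    using matrix_vector_mult_scaleR[of H "-1" "sgn g"] by simp
  then show ?thesis
    by (simp add: dir_second_deriv_def matrix_vector_mult_minus sgn_minus)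
qed

lemma abs_dir_second_deriv_le: "g \<noteq> 0 \<Longrightarrow> \<bar>dir_second_deriv g H\<bar> \<le> norm H"
  using inner_matrix_le[of "sgn g" H "sgn g"] by (simp add: dir_second_deriv_def norm_sgn)

lemma quad_poly_ray:
  assumes "g \<noteq> 0"
  shows "quad_poly g H (t *\<^sub>R sgn g) = t * norm g + t\<^sup>2 / 2 * dir_second_deriv g H"
proof -
  have "g \<bullet> sgn g = norm g"
    using assms by (simp add: sgn_div_norm power2_norm_eq_inner[symmetric] power2_eq_square)
  then show ?thesis
    by (simp add: quad_poly_def dir_second_deriv_def matrix_vector_mult_scaleR power2_eq_square)
qed

text \<open>On the ball of radius \<open>R\<close> the linear part is maximal at \<open>R n\<close>. A point at distance \<open>t\<close> from \<open>R n\<close>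
  loses at least \<open>G t\<^sup>2 / (2 R)\<close> in the linear part and gains at most \<open>|H| R t\<close> in the quadratic part;
  the difference is at most \<open>R\<^sup>3 |H|\<^sup>2 / (2 G)\<close> by completing the square.\<close>

lemma quad_poly_le:
  assumes g: "g \<noteq> 0" and R: "R > 0" and h: "norm h \<le> R"
  shows "quad_poly g H h \<le> R * norm g + R\<^sup>2 / 2 * dir_second_deriv g H
           + R^3 * (norm H)\<^sup>2 / (2 * norm g)"
proof -
  define G where "G = norm g"
  define n where "n = sgn g"
  define k where "k = h - R *\<^sub>R n"
  define t where "t = norm k"
  have G: "G > 0" using g by (simp add: G_def)
  have n: "norm n = 1" and gn: "g = G *\<^sub>R n" 
    using g by (simp_all add: n_def G_def norm_sgn sgn_div_norm)
  have hh: "h \<bullet> h \<le> R\<^sup>2" using h power_mono[OF h, of 2] by (simp add: power2_norm_eq_inner)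
  have nn: "n \<bullet> n = 1" using n by (simp flip: power2_norm_eq_inner)
  \<comment> \<open>The loss in the linear part: \<open>h\<close> and \<open>R n\<close> both lie in the ball, so their distance
    controls the difference of their components along \<open>n\<close>.\<close>
  have "t\<^sup>2 = h \<bullet> h - 2 * R * (n \<bullet> h) + R\<^sup>2"
    unfolding t_def power2_norm_eq_inner k_def
    by (simp add: inner_diff_left inner_diff_right nn inner_commute power2_eq_square algebra_simps)
  then have "2 * R * (n \<bullet> h) \<le> 2 * R\<^sup>2 - t\<^sup>2" using hh by simp
  then have "n \<bullet> h \<le> R - t\<^sup>2 / (2 * R)"
    using R by (simp add: field_simps power2_eq_square)
  then have lin: "g \<bullet> h \<le> G * (R - t\<^sup>2 / (2 * R))"
    using G by (simp add: gn)
  have "h \<bullet> (H *v h) - (R *\<^sub>R n) \<bullet> (H *v (R *\<^sub>R n)) = k \<bullet> (H *v h) + (R *\<^sub>R n) \<bullet> (H *v k)"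
    by (simp add: k_def matrix_vector_mult_diff_distrib inner_diff_left inner_diff_right)
  also have "\<dots> \<le> norm H * norm k * norm h + norm H * norm (R *\<^sub>R n) * norm k"
    using inner_matrix_le[of k H h] inner_matrix_le[of "R *\<^sub>R n" H k] by linarith
  also have "\<dots> \<le> norm H * t * R + norm H * R * t"
    using h R by (intro add_mono mult_mono) (auto simp: t_def n)
  finally have quad: "h \<bullet> (H *v h) \<le> R\<^sup>2 * dir_second_deriv g H + 2 * (norm H * R * t)"
    by (simp add: dir_second_deriv_def n_def matrix_vector_mult_scaleR power2_eq_square algebra_simps)
  have "0 \<le> (G * t - R\<^sup>2 * norm H)\<^sup>2 / (2 * R * G)"
    using R G by simp
  also have "\<dots> = G * t\<^sup>2 / (2 * R) - norm H * R * t + R^3 * (norm H)\<^sup>2 / (2 * G)"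
    using R G by (simp add: field_simps power2_eq_square power3_eq_cube)
  finally have sq: "norm H * R * t - G * t\<^sup>2 / (2 * R) \<le> R^3 * (norm H)\<^sup>2 / (2 * G)"
    by simp
  have "quad_poly g H h \<le> G * (R - t\<^sup>2 / (2 * R)) + R\<^sup>2 / 2 * dir_second_deriv g H + norm H * R * t"
    using lin quad by (simp add: quad_poly_def)
  also have "\<dots> = G * R + R\<^sup>2 / 2 * dir_second_deriv g H + (norm H * R * t - G * t\<^sup>2 / (2 * R))"
    by (simp add: algebra_simps)
  finally show ?thesis using sq by (simp add: G_def mult.commute)
qed

text \<open>The lower bound comes from approaching the boundary point \<open>R n\<close> along the ray; the ball is
  open, so the value there is only a limit.\<close>

lemma Sup_ball_expansion:
  fixes \<phi> :: "real^'n::finite \<Rightarrow> real"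
  assumes g: "g \<noteq> 0" and R: "R > 0"
    and e: "\<And>h. norm h < R \<Longrightarrow> \<bar>\<phi> (x + h) - \<phi> x - quad_poly g H h\<bar> \<le> e"
  shows bdd_above_ball: "bdd_above (\<phi> ` ball x R)"
    and Sup_ball_ge: "\<phi> x + R * norm g + R\<^sup>2 / 2 * dir_second_deriv g H - e \<le> (SUP y\<in>ball x R. \<phi> y)"
    and Sup_ball_le: "(SUP y\<in>ball x R. \<phi> y) \<le> \<phi> x + R * norm g + R\<^sup>2 / 2 * dir_second_deriv g H
           + R^3 * (norm H)\<^sup>2 / (2 * norm g) + e"
proof -
  have ub: "\<phi> y \<le> \<phi> x + R * norm g + R\<^sup>2 / 2 * dir_second_deriv g H
           + R^3 * (norm H)\<^sup>2 / (2 * norm g) + e" if "y \<in> ball x R" for y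
  proof -
    have "norm (y - x) < R" using that by (simp add: dist_norm norm_minus_commute)
    from e[OF this] quad_poly_le[OF g R less_imp_le[OF this], of H]
    show ?thesis by simp
  qed
  show bdd: "bdd_above (\<phi> ` ball x R)"
    using ub by (intro bdd_aboveI2)
  show "(SUP y\<in>ball x R. \<phi> y) \<le> \<phi> x + R * norm g + R\<^sup>2 / 2 * dir_second_deriv g H
           + R^3 * (norm H)\<^sup>2 / (2 * norm g) + e"
    using R ub by (intro cSUP_least) auto
  have "\<phi> x + t * norm g + t\<^sup>2 / 2 * dir_second_deriv g H - e \<le> (SUP y\<in>ball x R. \<phi> y)"
    if "t \<in> {0<..<R}" for t
  proof -
    have "norm (t *\<^sub>R sgn g) < R" using that g by (simp add: norm_sgn)
    from e[OF this] have "\<phi> x + t * norm g + t\<^sup>2 / 2 * dir_second_deriv g H - e \<le> \<phi> (x + t *\<^sub>R sgn g)"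
      by (simp add: quad_poly_ray[OF g])
    also have "\<dots> \<le> (SUP y\<in>ball x R. \<phi> y)"
      using \<open>norm (t *\<^sub>R sgn g) < R\<close> by (intro cSUP_upper bdd) (simp add: dist_norm)
    finally show ?thesis .
  qed
  then have "\<forall>\<^sub>F t in at_left R. \<phi> x + t * norm g + t\<^sup>2 / 2 * dir_second_deriv g H - e
                \<le> (SUP y\<in>ball x R. \<phi> y)"
    using R by (intro eventually_at_leftI[of 0]) auto
  moreover have "((\<lambda>t. \<phi> x + t * norm g + t\<^sup>2 / 2 * dir_second_deriv g H - e) \<longlongrightarrow>
                  \<phi> x + R * norm g + R\<^sup>2 / 2 * dir_second_deriv g H - e) (at_left R)"
    by (intro tendsto_intros) simp
  ultimately show "\<phi> x + R * norm g + R\<^sup>2 / 2 * dir_second_deriv g H - e \<le> (SUP y\<in>ball x R. \<phi> y)"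
    by (intro tendsto_upperbound) auto
qed

text \<open>This is the definition of the infimum on \<^typ>\<open>real\<close>, also for unbounded sets. Hence the passage from \<open>\<phi>\<close> to \<open>-\<phi>\<close> below has no side conditions.\<close>

lemma Inf_eq_minus_Sup:
  fixes f :: "'a \<Rightarrow> real"
  shows "(INF y\<in>A. f y) = - (SUP y\<in>A. - f y)"
  unfolding Inf_real_def image_image ..

lemma Inf_ball_expansion:
  fixes \<phi> :: "real^'n::finite \<Rightarrow> real"
  assumes g: "g \<noteq> 0" and R: "R > 0"
    and e: "\<And>h. norm h < R \<Longrightarrow> \<bar>\<phi> (x + h) - \<phi> x - quad_poly g H h\<bar> \<le> e"
  shows bdd_below_ball: "bdd_below (\<phi> ` ball x R)"
    and Inf_ball_le: "(INF y\<in>ball x R. \<phi> y) \<le> \<phi> x - R * norm g + R\<^sup>2 / 2 * dir_second_deriv g H + e"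
    and Inf_ball_ge: "\<phi> x - R * norm g + R\<^sup>2 / 2 * dir_second_deriv g H
           - R^3 * (norm H)\<^sup>2 / (2 * norm g) - e \<le> (INF y\<in>ball x R. \<phi> y)"
proof -
  have e': "\<bar>- \<phi> (x + h) - (- \<phi> x) - quad_poly (- g) (- H) h\<bar> \<le> e" if "norm h < R" for h
    using e[OF that] by (simp add: quad_poly_minus)
  have g': "- g \<noteq> 0" using g by simp
  note S = bdd_above_ball[where \<phi> = "\<lambda>y. - \<phi> y", OF g' R e']
    Sup_ball_ge[where \<phi> = "\<lambda>y. - \<phi> y", OF g' R e']
    Sup_ball_le[where \<phi> = "\<lambda>y. - \<phi> y", OF g' R e']
  show "bdd_below (\<phi> ` ball x R)"
    using S(1) by (simp only: bdd_above_uminus_image)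
  show "(INF y\<in>ball x R. \<phi> y) \<le> \<phi> x - R * norm g + R\<^sup>2 / 2 * dir_second_deriv g H + e"
    using S(2) by (simp add: Inf_eq_minus_Sup dir_second_deriv_minus)
  show "\<phi> x - R * norm g + R\<^sup>2 / 2 * dir_second_deriv g H
           - R^3 * (norm H)\<^sup>2 / (2 * norm g) - e \<le> (INF y\<in>ball x R. \<phi> y)"
    using S(3) by (simp add: Inf_eq_minus_Sup dir_second_deriv_minus)
qed

section \<open>Means of quadratic polynomials over a ball\<close>

lemma prod_Basis_cart:
  fixes v :: "real^'n::finite"
  shows "(\<Prod>b\<in>Basis. v \<bullet> b) = (\<Prod>i\<in>UNIV. v $ i)"
proof -
  have B: "(Basis :: (real^'n) set) = range (\<lambda>i. axis i 1)"
    by (auto simp: Basis_vec_def)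
  have "inj (\<lambda>i::'n. axis i (1::real))"
    by (auto simp: inj_on_def axis_eq_axis)
  then show ?thesis
    unfolding B by (subst prod.reindex) (simp_all add: inner_axis)
qed

text \<open>Sign changes and permutations of the coordinates map boxes to boxes of the same volume. Invariance
  under these maps determines the second moments of a ball up to one number.\<close>

lemma lborel_distr_signed_permutation:
  fixes \<sigma> :: "'n::finite \<Rightarrow> 'n" and s :: "'n \<Rightarrow> real"
  assumes \<sigma>: "bij \<sigma>" and s: "\<And>i. \<bar>s i\<bar> = 1"
  shows "distr lborel borel (\<lambda>y::real^'n. \<chi> i. s i * y $ \<sigma> i) = lborel"
proof (rule lborel_eqI[symmetric])
  let ?T = "\<lambda>y::real^'n. \<chi> i. s i * y $ \<sigma> i"
  fix l u :: "real^'n"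
  assume le: "\<And>b. b \<in> Basis \<Longrightarrow> l \<bullet> b \<le> u \<bullet> b"
  have le: "l $ i \<le> u $ i" for i
    using le[of "axis i 1"] by (simp add: inner_axis)
  have s1: "s i = 1 \<or> s i = - 1" for i using s[of i] by (auto simp: abs_if split: if_splits)
  define \<tau> where "\<tau> = inv \<sigma>"
  have \<tau>: "\<tau> (\<sigma> i) = i" "\<sigma> (\<tau> i) = i" for i
    using \<sigma> by (simp_all add: \<tau>_def bij_is_inj bij_is_surj surj_f_inv_f)
  have "bij \<tau>" using \<sigma> by (simp add: \<tau>_def bij_imp_bij_inv)
  define l' where "l' = (\<chi> j. if s (\<tau> j) = 1 then l $ \<tau> j else - u $ \<tau> j)"
  define u' where "u' = (\<chi> j. if s (\<tau> j) = 1 then u $ \<tau> j else - l $ \<tau> j)"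
  have m: "?T \<in> borel_measurable borel"
    by (intro borel_measurable_continuous_onI continuous_intros)
  have "?T -` box l u = box l' u'"
  proof (intro set_eqI)
    fix y
    have "(\<forall>i. l $ i < s i * y $ \<sigma> i \<and> s i * y $ \<sigma> i < u $ i) \<longleftrightarrow>
          (\<forall>j. l $ \<tau> j < s (\<tau> j) * y $ j \<and> s (\<tau> j) * y $ j < u $ \<tau> j)"
      by (metis \<tau>)
    moreover have "l $ \<tau> j < s (\<tau> j) * y $ j \<and> s (\<tau> j) * y $ j < u $ \<tau> j \<longleftrightarrow>
        l' $ j < y $ j \<and> y $ j < u' $ j" for j
      using s1[of "\<tau> j"] by (auto simp: l'_def u'_def)
    ultimately show "y \<in> ?T -` box l u \<longleftrightarrow> y \<in> box l' u'"
      by (simp add: mem_box_cart)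
  qed
  then have "emeasure (distr lborel borel ?T) (box l u) = emeasure lborel (box l' u')"
    using m by (simp add: emeasure_distr)
  also have "\<dots> = (\<Prod>b\<in>Basis. (u' - l') \<bullet> b)"
    by (rule emeasure_lborel_box) (auto simp: Basis_vec_def inner_axis l'_def u'_def le)
  also have "(\<Prod>b\<in>Basis. (u' - l') \<bullet> b) = (\<Prod>j\<in>UNIV. (u - l) $ \<tau> j)"
    unfolding prod_Basis_cart by (intro prod.cong) (auto simp: l'_def u'_def)
  also have "\<dots> = (\<Prod>i\<in>UNIV. (u - l) $ i)"
    using \<open>bij \<tau>\<close> by (rule prod.reindex_bij_betw)
  also have "\<dots> = (\<Prod>b\<in>Basis. (u - l) \<bullet> b)"
    by (rule prod_Basis_cart[symmetric])
  finally show "emeasure (distr lborel borel ?T) (box l u) = ennreal (\<Prod>b\<in>Basis. (u - l) \<bullet> b)" .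
qed simp

lemma ball_integral_signed_permutation:
  fixes \<sigma> :: "'n::finite \<Rightarrow> 'n" and s :: "'n \<Rightarrow> real" and f :: "real^'n \<Rightarrow> real"
  assumes \<sigma>: "bij \<sigma>" and s: "\<And>i. \<bar>s i\<bar> = 1" and f[measurable]: "f \<in> borel_measurable borel"
  shows "(LINT y:ball 0 R|lborel. f (\<chi> i. s i * y $ \<sigma> i)) = (LINT y:ball 0 R|lborel. f y)"
proof -
  let ?T = "\<lambda>y::real^'n. \<chi> i. s i * y $ \<sigma> i"
  have m: "?T \<in> borel_measurable borel"
    by (intro borel_measurable_continuous_onI continuous_intros)
  have "norm (?T y) = norm y" for y
  proof -
    have "(\<Sum>i\<in>UNIV. (s i * y $ \<sigma> i)\<^sup>2) = (\<Sum>i\<in>UNIV. (y $ \<sigma> i)\<^sup>2)"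
      using s by (simp add: power_mult_distrib flip: power2_abs[of "s _"])
    also have "\<dots> = (\<Sum>i\<in>UNIV. (y $ i)\<^sup>2)"
      by (rule sum.reindex_bij_betw[OF \<sigma>])
    finally show ?thesis by (simp add: norm_vec_def L2_set_def)
  qed
  then have ind: "indicator (ball 0 R) (?T y) = (indicator (ball 0 R) y :: real)" for y
    by (simp add: indicator_def)
  have "(LINT y:ball 0 R|lborel. f y) =
      (LINT y|distr lborel borel ?T. indicator (ball 0 R) y *\<^sub>R f y)"
    by (simp add: set_lebesgue_integral_def lborel_distr_signed_permutation[OF \<sigma> s])
  also have "\<dots> = (LINT y|lborel. indicator (ball 0 R) (?T y) *\<^sub>R f (?T y))"
    using m by (intro integral_distr borel_measurable_scaleR borel_measurable_indicator f) simp_all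
  finally show ?thesis by (simp add: set_lebesgue_integral_def ind)
qed

lemma set_integrable_ball:
  fixes f :: "'a::euclidean_space \<Rightarrow> real"
  assumes "continuous_on (cball x R) f"
  shows "set_integrable lborel (ball x R) f"
  by (rule set_integrable_subset[of _ "cball x R"])
     (use borel_integrable_compact[OF compact_cball assms] in \<open>auto simp: set_integrable_def\<close>)

lemma integral_ball_odd:
  fixes f :: "real^'n::finite \<Rightarrow> real"
  assumes f: "continuous_on UNIV f" and i: "\<And>y. f (\<chi> k. (if k = i then - 1 else 1) * y $ k) = - f y"
  shows "(LINT y:ball 0 R|lborel. f y) = 0"
proof -
  have "(LINT y:ball 0 R|lborel. f y)
      = (LINT y:ball 0 R|lborel. f (\<chi> k. (if k = i then - 1 else 1) * y $ id k))"
    using f by (intro ball_integral_signed_permutation[symmetric])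
      (auto intro: borel_measurable_continuous_onI simp flip: id_def)
  also have "\<dots> = - (LINT y:ball 0 R|lborel. f y)"
    using set_integral_uminus[OF set_integrable_ball[OF continuous_on_subset[OF f]], of 0 R]
    by (simp add: i)
  finally show ?thesis by simp
qed

lemma integral_ball_component:
  "(LINT y:ball 0 R|lborel. (y::real^'n::finite) $ i) = 0"
  by (rule integral_ball_odd[of _ i]) (auto intro!: continuous_intros)

lemma integral_ball_mixed:
  "i \<noteq> j \<Longrightarrow> (LINT y:ball 0 R|lborel. (y::real^'n::finite) $ i * y $ j) = 0"
  by (rule integral_ball_odd[of _ i]) (auto intro!: continuous_intros)

lemma integral_ball_square_eq:
  "(LINT y:ball 0 R|lborel. ((y::real^'n::finite) $ i)\<^sup>2) = (LINT y:ball 0 R|lborel. ((y::real^'n) $ j)\<^sup>2)"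
  using ball_integral_signed_permutation[of "Transposition.transpose i j" "\<lambda>_. 1" "\<lambda>y. (y $ j)\<^sup>2" R]
  by (auto intro!: borel_measurable_continuous_onI continuous_intros)

text \<open>Layer-cake formula: \<open>|y|\<^sup>2\<close> is the integral of \<open>2 t\<close> over \<open>0 \<le> t \<le> |y|\<close>. After exchanging the
  integrals, the set of points of the ball with \<open>|y| \<ge> t\<close> has volume proportional to \<open>R\<^sup>d - t\<^sup>d\<close>.\<close>

lemma integral_ball_norm_square:
  fixes R :: real
  assumes R: "R > 0"
  shows "(LINT y:ball 0 R|lborel. (norm (y::'a::euclidean_space))\<^sup>2)
     = real DIM('a) / (real DIM('a) + 2) * R\<^sup>2 * measure lborel (ball (0::'a) R)"
proof -
  define d where "d = DIM('a)"
  define w where "w = unit_ball_vol (real d)"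
  have w: "w \<ge> 0" by (simp add: w_def)
  have d: "d > 0" by (simp add: d_def)
  let ?I = "w * R ^ (d + 2) * (real d / (real d + 2))"
  have "(\<integral>\<^sup>+y. ennreal ((norm y)\<^sup>2) * indicator (ball (0::'a) R) y \<partial>lborel)
      = (\<integral>\<^sup>+(y::'a). (\<integral>\<^sup>+t. (if 0 \<le> t \<and> t \<le> norm y \<and> norm y < R then ennreal (2 * t) else 0) \<partial>lborel) \<partial>lborel)"
  proof (intro nn_integral_cong)
    fix y :: 'a
    have "(\<integral>\<^sup>+t. ennreal (2 * t) * indicator {0..norm y} t \<partial>lborel) = ennreal ((norm y)\<^sup>2 - 0\<^sup>2)"
      by (rule nn_integral_FTC_Icc) (auto intro!: derivative_eq_intros)
    moreover have "(if 0 \<le> t \<and> t \<le> norm y \<and> norm y < R then ennreal (2 * t) else 0)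
        = ennreal (2 * t) * indicator {0..norm y} t * indicator (ball 0 R) y" for t
      by (auto simp: indicator_def)
    ultimately show "ennreal ((norm y)\<^sup>2) * indicator (ball (0::'a) R) y =
      (\<integral>\<^sup>+t. (if 0 \<le> t \<and> t \<le> norm y \<and> norm y < R then ennreal (2 * t) else 0) \<partial>lborel)"
      by (simp add: nn_integral_multc)
  qed
  also have "\<dots> = (\<integral>\<^sup>+t. (\<integral>\<^sup>+(y::'a). (if 0 \<le> t \<and> t \<le> norm y \<and> norm y < R then ennreal (2 * t) else 0) \<partial>lborel) \<partial>lborel)"
    by (rule lborel_pair.Fubini') measurable
  also have "\<dots> = (\<integral>\<^sup>+t. ennreal (2 * t * (w * (R ^ d - t ^ d))) * indicator {0..R} t \<partial>lborel)"
  proof (intro nn_integral_cong)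
    fix t :: real
    show "(\<integral>\<^sup>+(y::'a). (if 0 \<le> t \<and> t \<le> norm y \<and> norm y < R then ennreal (2 * t) else 0) \<partial>lborel)
       = ennreal (2 * t * (w * (R ^ d - t ^ d))) * indicator {0..R} t"
    proof (cases "0 \<le> t \<and> t \<le> R")
      case True
      have "(\<integral>\<^sup>+(y::'a). (if 0 \<le> t \<and> t \<le> norm y \<and> norm y < R then ennreal (2 * t) else 0) \<partial>lborel)
         = (\<integral>\<^sup>+(y::'a). ennreal (2 * t) * indicator (ball 0 R - ball 0 t) y \<partial>lborel)"
        using True by (intro nn_integral_cong) (auto simp: indicator_def)
      also have "\<dots> = ennreal (2 * t) * emeasure lborel (ball (0::'a) R - ball 0 t)"
        by (rule nn_integral_cmult_indicator) auto
      also have "emeasure lborel (ball (0::'a) R - ball 0 t)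
         = emeasure lborel (ball (0::'a) R) - emeasure lborel (ball (0::'a) t)"
        using True emeasure_lborel_ball_finite[of "0::'a" t]
        by (intro emeasure_Diff) (auto simp: less_top)
      also have "\<dots> = ennreal (w * R ^ d) - ennreal (w * t ^ d)"
        using True by (simp add: emeasure_ball w_def d_def)
      also have "\<dots> = ennreal (w * (R ^ d - t ^ d))"
        using True w by (subst ennreal_minus) (auto simp: algebra_simps)
      finally show ?thesis
        using True w by (simp add: ennreal_mult power_mono)
    next
      case False
      then have "(if 0 \<le> t \<and> t \<le> norm y \<and> norm y < R then ennreal (2 * t) else 0) = 0" for y :: 'a
        by auto
      then show ?thesis using False by (simp only:) simp
    qed
  qed
  also have "\<dots> = ennreal ((w * (R ^ d * R\<^sup>2 - 2 * R ^ (d + 2) / (d + 2))) -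
                           (w * (R ^ d * 0\<^sup>2 - 2 * 0 ^ (d + 2) / (d + 2))))"
  proof (rule nn_integral_FTC_Icc[where F = "\<lambda>t. w * (R ^ d * t\<^sup>2 - 2 * t ^ (d + 2) / (d + 2))"])
    fix t assume "t \<in> {0..R}"
    then show "0 \<le> 2 * t * (w * (R ^ d - t ^ d))"
      using w by (simp add: power_mono)
    have "((\<lambda>t. w * (R ^ d * t\<^sup>2 - 2 * t ^ (d + 2) / (d + 2))) has_real_derivative
       w * (R ^ d * (2 * t) - 2 * (real (d + 2) * t ^ (d + 1)) / (d + 2))) (at t)"
      using DERIV_pow[of "d + 2" t] DERIV_pow[of 2 t]
      by (intro DERIV_cmult DERIV_diff DERIV_cdivide) simp_all
    also have "w * (R ^ d * (2 * t) - 2 * (real (d + 2) * t ^ (d + 1)) / (d + 2))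
       = 2 * t * (w * (R ^ d - t ^ d))"
    proof -
      have "2 * (real (d + 2) * t ^ (d + 1)) / (d + 2) = 2 * t ^ (d + 1)"
        by (simp del: of_nat_add)
      then show ?thesis by (simp only:) (simp add: algebra_simps)
    qed
    finally show "((\<lambda>t. w * (R ^ d * t\<^sup>2 - 2 * t ^ (d + 2) / (d + 2))) has_real_derivative
       2 * t * (w * (R ^ d - t ^ d))) (at t)" .
  qed (use R in auto)
  also have "(w * (R ^ d * R\<^sup>2 - 2 * R ^ (d + 2) / (d + 2))) -
                           (w * (R ^ d * 0\<^sup>2 - 2 * 0 ^ (d + 2) / (d + 2))) = ?I"
    by (simp add: field_simps power2_eq_square)
  finally have nn: "(\<integral>\<^sup>+y. ennreal ((norm y)\<^sup>2) * indicator (ball (0::'a) R) y \<partial>lborel) = ennreal ?I" .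
  have "(LINT y:ball 0 R|lborel. (norm (y::'a))\<^sup>2) = ?I"
    unfolding set_lebesgue_integral_def
  proof (rule integral_eq_nn_integral[THEN trans])
    have "(\<integral>\<^sup>+ y. ennreal (indicator (ball 0 R) y *\<^sub>R (norm (y::'a))\<^sup>2) \<partial>lborel) = ennreal ?I"
      by (subst nn[symmetric]) (auto intro!: nn_integral_cong simp: indicator_def)
    then show "enn2real (\<integral>\<^sup>+ y. ennreal (indicator (ball 0 R) y *\<^sub>R (norm (y::'a))\<^sup>2) \<partial>lborel) = ?I"
      using w R by simp
  qed (auto intro!: borel_measurable_times borel_measurable_power borel_measurable_indicator)
  also have "w * R ^ d = measure lborel (ball (0::'a) R)"
    using R by (simp add: content_ball w_def d_def)
  then have "?I = real d / (real d + 2) * R\<^sup>2 * measure lborel (ball (0::'a) R)"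
    by (simp add: power_add power2_eq_square flip: \<open>w * R ^ d = _\<close>)
  finally show ?thesis by (simp add: d_def)
qed

lemma set_integral_finite_sum:
  fixes f :: "'i \<Rightarrow> 'a \<Rightarrow> real"
  assumes "\<And>i. i \<in> I \<Longrightarrow> set_integrable M A (f i)"
  shows "(LINT y:A|M. \<Sum>i\<in>I. f i y) = (\<Sum>i\<in>I. LINT y:A|M. f i y)"
  using assms unfolding set_lebesgue_integral_def set_integrable_def
  by (simp add: sum_distrib_left Bochner_Integration.integral_sum)

lemma integral_ball_square:
  fixes R :: real
  assumes R: "R > 0"
  shows "(LINT y:ball 0 R|lborel. ((y::real^'n::finite) $ i)\<^sup>2)
     = R\<^sup>2 / (real CARD('n) + 2) * measure lborel (ball (0::real^'n) R)"
proof -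
  let ?S = "LINT y:ball 0 R|lborel. ((y::real^'n) $ i)\<^sup>2"
  have "real CARD('n) * ?S = (\<Sum>j\<in>UNIV. LINT y:ball 0 R|lborel. ((y::real^'n) $ j)\<^sup>2)"
    by (subst integral_ball_square_eq[of R _ i]) simp
  also have "\<dots> = (LINT y:ball 0 R|lborel. \<Sum>j\<in>UNIV. ((y::real^'n) $ j)\<^sup>2)"
    by (rule set_integral_finite_sum[symmetric]) (auto intro!: set_integrable_ball continuous_intros)
  also have "\<dots> = (LINT y:ball 0 R|lborel. (norm (y::real^'n))\<^sup>2)"
    by (simp add: norm_vec_def L2_set_def sum_nonneg)
  also have "\<dots> = real CARD('n) * (R\<^sup>2 / (real CARD('n) + 2) * measure lborel (ball (0::real^'n) R))"
    by (simp add: integral_ball_norm_square[OF R])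
  finally show ?thesis by (subst (asm) mult_cancel_left) simp
qed

text \<open>By symmetry only the squares of the coordinates contribute, which leaves the trace.\<close>

lemma integral_ball_quad_poly:
  fixes R :: real and H :: "real^'n^'n::finite"
  assumes R: "R > 0"
  shows "(LINT h:ball 0 R|lborel. quad_poly g H h)
     = R\<^sup>2 / (2 * (real CARD('n) + 2)) * trace H * measure lborel (ball (0::real^'n) R)"
proof -
  let ?V = "measure lborel (ball (0::real^'n) R)"
  have int: "set_integrable lborel (ball 0 R) f" if "continuous_on UNIV f" for f :: "real^'n \<Rightarrow> real"
    using that by (intro set_integrable_ball) (auto intro: continuous_on_subset)
  have "quad_poly g H h = (\<Sum>i\<in>UNIV. g $ i * h $ i + (\<Sum>j\<in>UNIV. (1/2 * H $ i $ j) * (h $ i * h $ j)))" for h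
    by (simp add: quad_poly_def inner_vec_def matrix_vector_mult_def sum.distrib sum_distrib_left mult_ac)
  then have "(LINT h:ball 0 R|lborel. quad_poly g H h) =
     (\<Sum>i\<in>UNIV. g $ i * (LINT h:ball 0 R|lborel. (h::real^'n) $ i) +
        (\<Sum>j\<in>UNIV. (1/2 * H $ i $ j) * (LINT h:ball 0 R|lborel. (h::real^'n) $ i * h $ j)))"
    by (simp add: set_integral_finite_sum set_integral_add int continuous_intros)
  also have "\<dots> = (\<Sum>i\<in>UNIV. \<Sum>j\<in>UNIV. if j = i then 1/2 * H $ i $ i * (R\<^sup>2 / (real CARD('n) + 2) * ?V) else 0)"
  proof -
    have "(1/2 * H $ i $ j) * (LINT h:ball 0 R|lborel. (h::real^'n) $ i * h $ j)
      = (if j = i then 1/2 * H $ i $ i * (R\<^sup>2 / (real CARD('n) + 2) * ?V) else 0)" for i j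
    proof (cases "j = i")
      case True
      then show ?thesis
        by (simp only: integral_ball_square[OF R, of i, unfolded power2_eq_square[of "_ $ _"]]) simp
    qed (simp add: integral_ball_mixed)
    then show ?thesis by (simp only: integral_ball_component) simp
  qed
  also have "\<dots> = R\<^sup>2 / (2 * (real CARD('n) + 2)) * trace H * ?V"
    by (simp add: trace_def sum_distrib_left sum_distrib_right sum_divide_distrib mult_ac)
  finally show ?thesis .
qed

section \<open>The expansion of the mean-value operator\<close>

text \<open>The mean is monotone and commutes with adding constants, so a uniform error of the polynomial
  approximation is inherited as it is.\<close>

lemma ball_average_expansion:
  fixes \<phi> :: "real^'n::finite \<Rightarrow> real"
  assumes R: "R > 0" and int: "set_integrable lborel (ball x R) \<phi>"
    and e: "\<And>h. norm h < R \<Longrightarrow> \<bar>\<phi> (x + h) - \<phi> x - quad_poly g H h\<bar> \<le> e"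
  shows "\<bar>(1 / measure lborel (ball x R)) * (LINT y:ball x R|lborel. \<phi> y)
          - (\<phi> x + R\<^sup>2 / (2 * (real CARD('n) + 2)) * trace H)\<bar> \<le> e"
proof -
  let ?B = "ball (0::real^'n) R"
  define V where "V = measure lborel ?B"
  define S where "S = R\<^sup>2 / (2 * (real CARD('n) + 2)) * trace H"
  have V: "V > 0" using R by (simp add: V_def content_ball)
  have V': "measure lborel (ball x R) = V" using R by (simp add: V_def content_ball)
  have cont: "continuous_on A (quad_poly g H)" for A
    unfolding quad_poly_def by (intro continuous_intros matrix_vector_mult_linear_continuous_on)
  have iconst: "set_integrable lborel ?B (\<lambda>_. c)" for c :: real
    by (intro set_integrable_ball continuous_intros)
  have iquad: "set_integrable lborel ?B (quad_poly g H)"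
    by (intro set_integrable_ball cont)
  have Lconst: "(LINT h:?B|lborel. c) = c * V" for c :: real
    by (simp add: V_def set_lebesgue_integral_def)
  have ind: "indicator (ball x R) (x + h) = (indicator ?B h :: real)" for h :: "real^'n"
    by (simp add: indicator_def dist_norm)
  have m: "(\<lambda>y. indicator (ball x R) y *\<^sub>R \<phi> y) \<in> borel_measurable borel"
    using int by (simp add: set_integrable_def borel_measurable_integrable)
  have shift: "(LINT y:ball x R|lborel. \<phi> y) = (LINT h:?B|lborel. \<phi> (x + h))"
  proof -
    have "(LINT y:ball x R|lborel. \<phi> y) = (LINT y|distr lborel borel ((+) x). indicator (ball x R) y *\<^sub>R \<phi> y)"
      by (simp add: set_lebesgue_integral_def lborel_distr_plus)
    also have "\<dots> = (LINT h|lborel. indicator (ball x R) (x + h) *\<^sub>R \<phi> (x + h))"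
      by (rule integral_distr[OF _ m]) simp
    finally show ?thesis by (simp add: set_lebesgue_integral_def ind)
  qed
  have i\<phi>: "set_integrable lborel ?B (\<lambda>h. \<phi> (x + h))"
  proof -
    have "integrable (distr lborel borel ((+) x)) (\<lambda>y. indicator (ball x R) y *\<^sub>R \<phi> y)"
      using int by (simp add: set_integrable_def lborel_distr_plus)
    then have "integrable lborel (\<lambda>h. indicator (ball x R) (x + h) *\<^sub>R \<phi> (x + h))"
      by (subst (asm) integrable_distr_eq) (use m in auto)
    then show ?thesis by (simp add: set_integrable_def ind)
  qed
  have lo: "(\<phi> x - e) * V + S * V \<le> (LINT h:?B|lborel. \<phi> (x + h))"
  proof -
    have "(LINT h:?B|lborel. (\<phi> x - e) + quad_poly g H h) \<le> (LINT h:?B|lborel. \<phi> (x + h))"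
      by (intro set_integral_mono set_integral_add iconst iquad i\<phi>) (use e in \<open>force simp: abs_le_iff\<close>)
    then show ?thesis
      by (simp add: set_integral_add iconst iquad Lconst integral_ball_quad_poly[OF R] S_def V_def)
  qed
  have hi: "(LINT h:?B|lborel. \<phi> (x + h)) \<le> (\<phi> x + e) * V + S * V"
  proof -
    have "(LINT h:?B|lborel. \<phi> (x + h)) \<le> (LINT h:?B|lborel. (\<phi> x + e) + quad_poly g H h)"
      by (intro set_integral_mono set_integral_add iconst iquad i\<phi>) (use e in \<open>force simp: abs_le_iff\<close>)
    then show ?thesis
      by (simp add: set_integral_add iconst iquad Lconst integral_ball_quad_poly[OF R] S_def V_def)
  qed
  have "(1 / V) * (LINT y:ball x R|lborel. \<phi> y) \<le> \<phi> x + e + S"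
    "\<phi> x - e + S \<le> (1 / V) * (LINT y:ball x R|lborel. \<phi> y)"
    using lo hi V by (simp_all add: shift field_simps)
  then show ?thesis unfolding V' S_def[symmetric] by linarith
qed

text \<open>The bracket in the expression of the p-Laplacian as \<open>|\<nabla>\<phi>|\<^sup>p\<^sup>-\<^sup>2\<close> times a second-order term.\<close>

definition normalized_p_lap :: "real \<Rightarrow> real^'n::finite \<Rightarrow> real^'n^'n \<Rightarrow> real" where
  "normalized_p_lap p g H = (p - 2) * dir_second_deriv g H + trace H"

text \<open>In half the sum of supremum and infimum the linear terms cancel and \<open>R\<^sup>2/2 \<langle>Hn, n\<rangle>\<close> remains. The
  constants are chosen such that \<open>\<beta> R\<^sup>2 = 2 (p - 2) r\<^sup>2\<close> and \<open>(1 - \<beta>) R\<^sup>2 = 2 (d + 2) r\<^sup>2\<close>.\<close>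

lemma mean_op_expansion:
  fixes \<phi> :: "real^'n::finite \<Rightarrow> real"
  assumes p: "p > 2" and g: "g \<noteq> 0" and r: "r > 0"
    and R_def: "R = gamma_const p CARD('n) * r"
    and int: "set_integrable lborel (ball x R) \<phi>"
    and e: "\<And>h. norm h < R \<Longrightarrow> \<bar>\<phi> (x + h) - \<phi> x - quad_poly g H h\<bar> \<le> e"
  shows "\<bar>mean_op p r \<phi> x - (\<phi> x + r\<^sup>2 * normalized_p_lap p g H)\<bar>
          \<le> e + R ^ 3 * ((norm H)\<^sup>2 / norm g)"
proof -
  define d where "d = real CARD('n)"
  define b where "b = beta_const p CARD('n)"
  define Q where "Q = R ^ 3 * (norm H)\<^sup>2 / (2 * norm g)"
  define S where "S = (SUP y\<in>ball x R. \<phi> y)"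
  define I where "I = (INF y\<in>ball x R. \<phi> y)"
  define M where "M = (1 / measure lborel (ball x R)) * (LINT y:ball x R|lborel. \<phi> y)"
  have d: "d > 0" by (simp add: d_def)
  have b_eq: "b = (p - 2) / (p + d)" by (simp add: b_def d_def beta_const_def)
  have b: "0 \<le> b" "b \<le> 1" using p d by (auto simp: b_eq)
  have R: "R > 0" using p r d by (simp add: R_def gamma_const_def d_def)
  have R2: "R\<^sup>2 = 2 * (p + d) * r\<^sup>2"
    using p d by (simp add: R_def gamma_const_def power_mult_distrib d_def)
  have Q: "Q \<ge> 0" using R by (simp add: Q_def)
  have mid: "\<bar>(1/2 * S + 1/2 * I) - (\<phi> x + R\<^sup>2 / 2 * dir_second_deriv g H)\<bar> \<le> e + Q / 2"
    using Sup_ball_ge[OF g R e] Sup_ball_le[OF g R e] Inf_ball_ge[OF g R e] Inf_ball_le[OF g R e] Q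
    by (simp add: S_def I_def Q_def abs_le_iff)
  have avg: "\<bar>M - (\<phi> x + R\<^sup>2 / (2 * (d + 2)) * trace H)\<bar> \<le> e"
    unfolding M_def d_def by (rule ball_average_expansion[OF R int e])
  have "mean_op p r \<phi> x = b * (1/2 * S + 1/2 * I) + (1 - b) * M"
    by (simp add: mean_op_def Let_def b_def S_def I_def M_def R_def)
  moreover have "b * (R\<^sup>2 / 2 * dir_second_deriv g H) + (1 - b) * (R\<^sup>2 / (2 * (d + 2)) * trace H)
      = r\<^sup>2 * normalized_p_lap p g H"
  proof -
    have 1: "b * R\<^sup>2 = 2 * (p - 2) * r\<^sup>2"
      using p d by (simp add: b_eq R2 field_simps)
    have 2: "(1 - b) * R\<^sup>2 = 2 * (d + 2) * r\<^sup>2"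
      using p d by (simp add: b_eq R2 field_simps)
    have "b * R\<^sup>2 * (1/2 * dir_second_deriv g H) + (1 - b) * R\<^sup>2 * (1 / (2 * (d + 2)) * trace H)
      = r\<^sup>2 * normalized_p_lap p g H"
      unfolding 1 2 using d by (simp add: normalized_p_lap_def field_simps)
    then show ?thesis by (simp add: mult_ac)
  qed
  ultimately have eq: "mean_op p r \<phi> x - (\<phi> x + r\<^sup>2 * normalized_p_lap p g H)
      = b * ((1/2 * S + 1/2 * I) - (\<phi> x + R\<^sup>2 / 2 * dir_second_deriv g H))
        + (1 - b) * (M - (\<phi> x + R\<^sup>2 / (2 * (d + 2)) * trace H))"
    by (simp add: algebra_simps)
  have "\<bar>mean_op p r \<phi> x - (\<phi> x + r\<^sup>2 * normalized_p_lap p g H)\<bar>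
      \<le> b * \<bar>(1/2 * S + 1/2 * I) - (\<phi> x + R\<^sup>2 / 2 * dir_second_deriv g H)\<bar>
        + (1 - b) * \<bar>M - (\<phi> x + R\<^sup>2 / (2 * (d + 2)) * trace H)\<bar>"
    unfolding eq using b by (intro order_trans[OF abs_triangle_ineq]) (simp add: abs_mult)
  also have "\<dots> \<le> b * (e + Q / 2) + (1 - b) * e"
    by (intro add_mono mult_left_mono mid avg) (use b in auto)
  also have "\<dots> = e + b * (Q / 2)" by (simp add: algebra_simps)
  \<comment> \<open>A generous bound, so that the error appears as a multiple of \<open>R\<^sup>3 |H|\<^sup>2 / G\<close> with factor one.\<close>
  also have "b * (Q / 2) \<le> 1 * (2 * Q)"
    using b Q by (intro mult_mono) auto
  also have "1 * (2 * Q) = R ^ 3 * ((norm H)\<^sup>2 / norm g)" by (simp add: Q_def)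
  finally show ?thesis by simp
qed

section \<open>The range of the scaling parameter and Young's inequality\<close>

lemma alpha_const_bounds: "p > 2 \<Longrightarrow> 0 < alpha_const p" "p > 2 \<Longrightarrow> alpha_const p < 1"
  by (simp_all add: alpha_const_def)

lemma m_eps_eq: "p > 2 \<Longrightarrow> m_eps p \<epsilon> = \<epsilon> powr (2 * (p - 1) / (3 * p - 4))"
  unfolding m_eps_def alpha_const_def by (rule arg_cong[where f = "\<lambda>e. \<epsilon> powr e"]) (simp add: field_simps)

lemma M_eps_eq: "p > 2 \<Longrightarrow> M_eps p \<epsilon> = \<epsilon> powr (- (2 * (p - 1) / p))"
  unfolding M_eps_def alpha_const_def by (rule arg_cong[where f = "\<lambda>e. \<epsilon> powr e"]) (simp add: field_simps)

lemma m_eps_le_M_eps: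
  assumes "p > 2" "0 < \<epsilon>" "\<epsilon> < 1"
  shows "0 < m_eps p \<epsilon>" "m_eps p \<epsilon> \<le> M_eps p \<epsilon>"
  using assms by (auto simp: m_eps_eq M_eps_eq intro!: powr_mono' intro: order_trans[of _ 0])

lemma m_eps_powers:
  assumes p: "p > 2" and \<epsilon>: "0 < \<epsilon>"
  shows "m_eps p \<epsilon> powr (1 - alpha_const p) = \<epsilon> powr (2 / (3 * p - 4))"
    and "m_eps p \<epsilon> ^ 3 = \<epsilon>\<^sup>2 * \<epsilon> powr (2 / (3 * p - 4))"
proof -
  show "m_eps p \<epsilon> powr (1 - alpha_const p) = \<epsilon> powr (2 / (3 * p - 4))"
  proof -
    have "1 - alpha_const p = 1 / (p - 1)" using p by (simp add: alpha_const_def field_simps)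
    moreover have "2 * q / k * (1 / q) = 2 / k" if "q \<noteq> 0" for q k :: real using that by simp
    from this[of "p - 1" "3 * p - 4"] have "2 * (p - 1) / (3 * p - 4) * (1 / (p - 1)) = 2 / (3 * p - 4)"
      using p by simp
    ultimately show ?thesis by (simp only: m_eps_eq[OF p] powr_powr)
  qed
  have "m_eps p \<epsilon> ^ 3 = \<epsilon> powr (2 * (p - 1) / (3 * p - 4) * 3)"
    using p \<epsilon> by (simp add: m_eps_eq powr_powr flip: powr_realpow)
  also have "2 * (p - 1) / (3 * p - 4) * 3 = 2 + 2 / (3 * p - 4)"
    using p by (simp add: field_simps)
  finally show "m_eps p \<epsilon> ^ 3 = \<epsilon>\<^sup>2 * \<epsilon> powr (2 / (3 * p - 4))"
    using \<epsilon> by (simp add: powr_add)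
qed

text \<open>The two radii of the averaging operator. The endpoints of the range satisfy \<open>m\<^sup>2\<^sup>+\<^sup>a = \<epsilon>\<^sup>2\<close> and
  \<open>M\<^sup>2\<^sup>-\<^sup>a = \<epsilon>\<^sup>-\<^sup>2\<close>, which is equivalent to \<open>r = m\<close> at \<open>c = m\<close> and \<open>\<rho> = 1/M\<close> at \<open>c = M\<close>. These are the
  largest values of \<open>r\<close> and \<open>\<rho>\<close>, and the exponents of the theorem are those of \<open>M\<^sup>-\<^sup>2/\<epsilon>\<^sup>2\<close> and \<open>m\<^sup>3/\<epsilon>\<^sup>2\<close>.\<close>

lemma radius_bounds:
  fixes p \<epsilon> c :: real
  defines "\<rho> \<equiv> \<epsilon>\<^sup>2 * c powr (1 - alpha_const p)" and "r \<equiv> \<epsilon> * c powr (- alpha_const p / 2)"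
  assumes p: "p > 2" and \<epsilon>: "0 < \<epsilon>" "\<epsilon> < 1" and c: "c \<in> {m_eps p \<epsilon>..M_eps p \<epsilon>}"
  shows "0 < \<rho>" "0 < r" "\<rho> \<le> m_eps p \<epsilon>" "r \<le> m_eps p \<epsilon>"
    "\<rho>\<^sup>2 \<le> \<epsilon>\<^sup>2 * \<epsilon> powr (2 * (p - 2) / p)"
    "\<rho> ^ 3 \<le> \<epsilon>\<^sup>2 * \<epsilon> powr (2 / (3 * p - 4))" "r ^ 3 \<le> \<epsilon>\<^sup>2 * \<epsilon> powr (2 / (3 * p - 4))"
    "r\<^sup>2 = \<epsilon>\<^sup>2 * c powr (- alpha_const p)"
proof -
  let ?a = "alpha_const p"
  note a = alpha_const_bounds[OF p]
  have m: "0 < m_eps p \<epsilon>" using m_eps_le_M_eps[OF p \<epsilon>] by simp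
  have c0: "c > 0" using c m by simp
  show \<rho>: "0 < \<rho>" and r: "0 < r" using \<epsilon> c0 by (simp_all add: \<rho>_def r_def)
  show "r\<^sup>2 = \<epsilon>\<^sup>2 * c powr (- ?a)"
    using c0 by (simp add: r_def power_mult_distrib powr_powr flip: powr_realpow)
  have "\<rho> \<le> \<epsilon>\<^sup>2 * M_eps p \<epsilon> powr (1 - ?a)"
    unfolding \<rho>_def using c c0 a by (intro mult_left_mono powr_mono2) auto
  also have "\<dots> = \<epsilon> powr (2 + (- (2 * (p - 1) / p)) * (1 - ?a))"
    unfolding M_eps_eq[OF p] powr_powr powr_add using \<epsilon> by simp
  also have "2 + (- (2 * (p - 1) / p)) * (1 - ?a) = 2 * (p - 1) / p"
    using p by (simp add: alpha_const_def field_simps)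
  finally have \<rho>_le: "\<rho> \<le> \<epsilon> powr (2 * (p - 1) / p)" .
  also have "\<dots> \<le> m_eps p \<epsilon>"
    unfolding m_eps_eq[OF p] using p \<epsilon> by (intro powr_mono') (auto intro!: divide_left_mono)
  finally show \<rho>m: "\<rho> \<le> m_eps p \<epsilon>" .
  have "r \<le> \<epsilon> * m_eps p \<epsilon> powr (- ?a / 2)"
    unfolding r_def using c m a \<epsilon> by (intro mult_left_mono powr_mono2') auto
  also have "\<dots> = \<epsilon> powr (1 + (2 * (p - 1) / (3 * p - 4)) * (- ?a / 2))"
    unfolding m_eps_eq[OF p] powr_powr using \<epsilon> by (simp only: powr_add powr_one)
  also have "1 + (2 * (p - 1) / (3 * p - 4)) * (- ?a / 2) = 2 * (p - 1) / (3 * p - 4)"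
  proof -
    have "(p - 1) * ?a = p - 2" using p by (simp add: alpha_const_def)
    moreover have "1 + (2 * q / k) * (- b / 2) = 1 - q * b / k" for q k b :: real by simp
    from this[of "p - 1" "3 * p - 4" ?a]
    have "1 + (2 * (p - 1) / (3 * p - 4)) * (- ?a / 2) = 1 - (p - 1) * ?a / (3 * p - 4)" .
    ultimately show ?thesis using p by (simp only:) (simp add: field_simps)
  qed
  finally show rm: "r \<le> m_eps p \<epsilon>" by (simp add: m_eps_eq[OF p])
  have "\<rho>\<^sup>2 \<le> (\<epsilon> powr (2 * (p - 1) / p))\<^sup>2"
    using \<rho>_le \<rho> by (intro power_mono) auto
  also have "\<dots> = \<epsilon> powr (2 * (p - 1) / p * 2)"
    using \<epsilon> by (simp add: powr_powr flip: powr_realpow)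
  also have "2 * (p - 1) / p * 2 = 2 + 2 * (p - 2) / p"
    using p by (simp add: field_simps)
  finally show "\<rho>\<^sup>2 \<le> \<epsilon>\<^sup>2 * \<epsilon> powr (2 * (p - 2) / p)"
    using \<epsilon> by (simp add: powr_add)
  show "\<rho> ^ 3 \<le> \<epsilon>\<^sup>2 * \<epsilon> powr (2 / (3 * p - 4))" "r ^ 3 \<le> \<epsilon>\<^sup>2 * \<epsilon> powr (2 / (3 * p - 4))"
    using power_mono[OF \<rho>m, of 3] power_mono[OF rm, of 3] \<rho> r by (simp_all add: m_eps_powers[OF p \<epsilon>(1)])
qed

text \<open>The coefficient of \<open>\<epsilon>\<^sup>2\<close> in the functional with parameter \<open>c\<close>.\<close>

definition young_fun :: "real \<Rightarrow> real \<Rightarrow> real \<Rightarrow> real \<Rightarrow> real" where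
  "young_fun a G L c = a * c powr (1 - a) * G + (1 - a) * c powr (- a) * L"

text \<open>Weighted inequality of arithmetic and geometric mean, with weights \<open>a\<close> and \<open>1 - a\<close>: the powers
  of \<open>c\<close> cancel in the geometric mean.\<close>

lemma young_fun_ge:
  assumes "0 < a" "a < 1" "G > 0" "L \<ge> 0" "c > 0"
  shows "L powr (1 - a) * G powr a \<le> young_fun a G L c"
proof (cases "L = 0")
  case False
  then have L: "L > 0" using assms by simp
  have "L powr (1 - a) * G powr a = (c powr (1 - a) * G) powr a * (c powr (- a) * L) powr (1 - a)"
    using assms L by (simp add: powr_mult powr_powr mult_ac) (simp add: powr_minus)
  also have "\<dots> \<le> a * (c powr (1 - a) * G) + (1 - a) * (c powr (- a) * L)"
    using assms L by (intro Youngs_inequality_0) auto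
  finally show ?thesis by (simp add: young_fun_def mult_ac)
qed (use assms in \<open>simp add: young_fun_def\<close>)

lemma young_fun_argmin:
  assumes "0 < a" "a < 1" "G > 0" "L > 0"
  shows "young_fun a G L (L / G) = L powr (1 - a) * G powr a"
proof -
  have "(L / G) powr (1 - a) * G = L powr (1 - a) * (G powr 1 / G powr (1 - a))"
    using assms by (simp add: powr_divide)
  also have "\<dots> = L powr (1 - a) * G powr a"
    by (subst powr_diff[symmetric]) simp
  finally have 1: "(L / G) powr (1 - a) * G = L powr (1 - a) * G powr a" .
  have "(L / G) powr (- a) * L = (L powr 1 * L powr (- a)) / G powr (- a)"
    using assms by (simp add: powr_divide mult_ac)
  also have "\<dots> = L powr (1 - a) * G powr a"
    by (subst powr_add[symmetric]) (simp add: powr_minus divide_simps)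
  finally have 2: "(L / G) powr (- a) * L = L powr (1 - a) * G powr a" .
  show ?thesis unfolding young_fun_def using 1 2 by (simp add: mult.assoc) (simp add: algebra_simps)
qed

text \<open>The exponents match since \<open>1 - a = 1/(p - 1)\<close> and \<open>a = (p - 2)/(p - 1)\<close>.\<close>

lemma J_eq:
  assumes p: "p > 2" and "G > 0" "L \<ge> 0"
  shows "J p (G powr (p - 2) * L) = L powr (1 - alpha_const p) * G powr alpha_const p"
proof -
  have "1 - alpha_const p = 1 / (p - 1)"
    using p by (simp add: alpha_const_def field_simps)
  then show ?thesis
    using assms by (simp add: J_def powr_mult powr_powr alpha_const_def)
qed

section \<open>The functional minimised by the averaging operator\<close>

text \<open>All that the asymptotics use of \<open>\<phi>\<close>. The two remainder terms serve two situations: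
  \<open>\<eta>3 = 0\<close> with arbitrarily small \<open>\<eta>2\<close> for \<open>C\<^sup>2\<close> functions, and \<open>\<eta>2 = 0\<close> for \<open>C\<^sup>3\<close> functions.\<close>

definition quadratic_approx :: "(real^'n::finite \<Rightarrow> real) \<Rightarrow> real^'n \<Rightarrow> real^'n \<Rightarrow> real^'n^'n \<Rightarrow> real \<Rightarrow> real \<Rightarrow> real \<Rightarrow> bool"
  where "quadratic_approx \<phi> x g H \<delta> \<eta>2 \<eta>3 \<longleftrightarrow> 0 \<le> \<eta>2 \<and> 0 \<le> \<eta>3 \<and> continuous_on (ball x \<delta>) \<phi> \<and>
     (\<forall>h. norm h < \<delta> \<longrightarrow>
        \<bar>\<phi> (x + h) - \<phi> x - quad_poly g H h\<bar> \<le> \<eta>2 * (norm h)\<^sup>2 + \<eta>3 * norm h ^ 3)"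

lemma quadratic_approx_minus:
  assumes "quadratic_approx \<phi> x g H \<delta> \<eta>2 \<eta>3"
  shows "quadratic_approx (\<lambda>y. - \<phi> y) x (- g) (- H) \<delta> \<eta>2 \<eta>3"
proof -
  have "\<bar>- \<phi> (x + h) - - \<phi> x - quad_poly (- g) (- H) h\<bar> = \<bar>\<phi> (x + h) - \<phi> x - quad_poly g H h\<bar>" for h
    by (simp add: quad_poly_minus)
  then show ?thesis using assms unfolding quadratic_approx_def by (auto intro: continuous_on_minus)
qed

lemma quadratic_approx_ball:
  assumes "quadratic_approx \<phi> x g H \<delta> \<eta>2 \<eta>3" "R \<le> \<delta>" "norm h < R"
  shows "\<bar>\<phi> (x + h) - \<phi> x - quad_poly g H h\<bar> \<le> \<eta>2 * R\<^sup>2 + \<eta>3 * R ^ 3"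
proof -
  have "\<bar>\<phi> (x + h) - \<phi> x - quad_poly g H h\<bar> \<le> \<eta>2 * (norm h)\<^sup>2 + \<eta>3 * norm h ^ 3"
    using assms by (simp add: quadratic_approx_def)
  also have "\<dots> \<le> \<eta>2 * R\<^sup>2 + \<eta>3 * R ^ 3"
    using assms by (intro add_mono mult_left_mono power_mono) (auto simp: quadratic_approx_def)
  finally show ?thesis .
qed

lemma quadratic_approx_integrable:
  assumes "quadratic_approx \<phi> x g H \<delta> \<eta>2 \<eta>3" "R < \<delta>"
  shows "set_integrable lborel (ball x R) \<phi>"
  using assms by (intro set_integrable_ball) (auto simp: quadratic_approx_def intro: continuous_on_subset)

text \<open>The part of the error that, after division by \<open>\<epsilon>\<^sup>2\<close>, tends to zero uniformly in \<open>c\<close>. The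
  contribution of \<open>\<eta>2\<close> to the mean-value operator does not, and is kept separate.\<close>

definition body_error :: "real \<Rightarrow> nat \<Rightarrow> real^'n::finite \<Rightarrow> real^'n^'n \<Rightarrow> real \<Rightarrow> real \<Rightarrow> real \<Rightarrow> real" where
  "body_error p d g H \<eta>2 \<eta>3 \<epsilon> = (norm H / 2 + \<eta>2) * \<epsilon> powr (2 * (p - 2) / p)
     + (1 + gamma_const p d ^ 3) * ((norm H)\<^sup>2 / norm g + \<eta>3) * \<epsilon> powr (2 / (3 * p - 4))"

lemma gamma_const_ge_1: "p > 2 \<Longrightarrow> gamma_const p d \<ge> 1"
  by (simp add: gamma_const_def)

text \<open>The small ball of radius \<open>\<rho>\<close> contributes the errors \<open>\<rho>\<^sup>2 |H|\<close> and \<open>\<eta>2 \<rho>\<^sup>2\<close>, hence the first power of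
  \<open>\<epsilon>\<close>; all cubic errors give the second power. The last term is the quadratic remainder on the ball
  of radius \<open>\<gamma> r\<close>, where \<open>r\<^sup>2 = \<epsilon>\<^sup>2 c\<^sup>-\<^sup>a\<close>.\<close>

lemma A_plus_body_expansion:
  fixes \<phi> :: "real^'n::finite \<Rightarrow> real" and p :: real
  defines "\<gamma> \<equiv> gamma_const p CARD('n)"
  assumes p: "p > 2" and g: "g \<noteq> 0" and T: "quadratic_approx \<phi> x g H \<delta> \<eta>2 \<eta>3"
    and \<epsilon>: "0 < \<epsilon>" "\<epsilon> < 1" "\<gamma> * m_eps p \<epsilon> < \<delta>" and c: "c \<in> {m_eps p \<epsilon>..M_eps p \<epsilon>}"
  shows "\<bar>A_plus_body p \<epsilon> \<phi> x c - (\<phi> x + \<epsilon>\<^sup>2 * young_fun (alpha_const p) (norm g) (normalized_p_lap p g H) c)\<bar>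
    \<le> \<epsilon>\<^sup>2 * (body_error p CARD('n) g H \<eta>2 \<eta>3 \<epsilon> + (1 - alpha_const p) * c powr (- alpha_const p) * (\<gamma>\<^sup>2 * \<eta>2))"
proof -
  define a where "a = alpha_const p"
  define G where "G = norm g"
  define L where "L = normalized_p_lap p g H"
  define \<rho> where "\<rho> = \<epsilon>\<^sup>2 * c powr (1 - a)"
  define r where "r = \<epsilon> * c powr (- a / 2)"
  define R where "R = \<gamma> * r"
  define \<theta> where "\<theta> = \<epsilon> powr (2 * (p - 2) / p)"
  define \<tau> where "\<tau> = \<epsilon> powr (2 / (3 * p - 4))"
  define Z where "Z = (norm H)\<^sup>2 / G"
  define S where "S = (SUP y\<in>ball x \<rho>. \<phi> y)"
  define M where "M = mean_op p r \<phi> x"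
  have a: "0 < a" "a < 1" using alpha_const_bounds[OF p] by (simp_all add: a_def)
  have \<gamma>: "\<gamma> \<ge> 1" using gamma_const_ge_1[OF p] by (simp add: \<gamma>_def)
  have \<eta>: "\<eta>2 \<ge> 0" "\<eta>3 \<ge> 0" using T by (simp_all add: quadratic_approx_def)
  have G: "G > 0" using g by (simp add: G_def)
  have Z: "Z \<ge> 0" using G by (simp add: Z_def)
  note rb = radius_bounds[OF p \<epsilon>(1,2) c, folded a_def, folded \<rho>_def r_def \<theta>_def \<tau>_def]
  have m: "m_eps p \<epsilon> > 0" using rb(1,3) by simp
  have "\<gamma> * r \<le> \<gamma> * m_eps p \<epsilon>"
    using \<gamma> rb(4) by (intro mult_left_mono) auto
  then have "R < \<delta>" using \<epsilon>(3) unfolding R_def by linarith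
  moreover have "0 < R" using \<gamma> rb(2) by (simp add: R_def)
  ultimately have R: "0 < R" "R < \<delta>" by simp_all
  have \<rho>\<delta>: "\<rho> \<le> \<delta>"
    using rb(3) \<epsilon>(3) mult_right_mono[OF \<gamma>, of "m_eps p \<epsilon>"] m by linarith
  have e\<rho>: "\<And>h. norm h < \<rho> \<Longrightarrow> \<bar>\<phi> (x + h) - \<phi> x - quad_poly g H h\<bar> \<le> \<eta>2 * \<rho>\<^sup>2 + \<eta>3 * \<rho> ^ 3"
    using quadratic_approx_ball[OF T \<rho>\<delta>] .
  have "\<bar>S - (\<phi> x + \<rho> * G)\<bar> \<le> \<rho>\<^sup>2 / 2 * norm H + \<rho> ^ 3 * (Z / 2) + (\<eta>2 * \<rho>\<^sup>2 + \<eta>3 * \<rho> ^ 3)"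
  proof -
    have "\<bar>\<rho>\<^sup>2 / 2 * dir_second_deriv g H\<bar> \<le> \<rho>\<^sup>2 / 2 * norm H"
      using abs_dir_second_deriv_le[OF g, of H] by (simp add: abs_mult mult_left_mono)
    moreover have "\<rho> ^ 3 * (Z / 2) \<ge> 0" using rb(1) Z by simp
    moreover have "\<rho> ^ 3 * (norm H)\<^sup>2 / (2 * norm g) = \<rho> ^ 3 * (Z / 2)" by (simp add: Z_def G_def)
    ultimately show ?thesis
      using Sup_ball_ge[OF g rb(1) e\<rho>] Sup_ball_le[OF g rb(1) e\<rho>]
      unfolding S_def G_def abs_le_iff by linarith
  qed
  also have "\<dots> = (norm H / 2 + \<eta>2) * \<rho>\<^sup>2 + (Z / 2 + \<eta>3) * \<rho> ^ 3"
    by (simp add: algebra_simps)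
  also have "\<dots> \<le> (norm H / 2 + \<eta>2) * (\<epsilon>\<^sup>2 * \<theta>) + (Z + \<eta>3) * (\<epsilon>\<^sup>2 * \<tau>)"
    using rb Z \<eta> by (intro add_mono mult_mono) auto
  finally have sup: "\<bar>S - (\<phi> x + \<rho> * G)\<bar> \<le> \<epsilon>\<^sup>2 * ((norm H / 2 + \<eta>2) * \<theta> + (Z + \<eta>3) * \<tau>)"
    by (simp add: algebra_simps)
  have eR: "\<And>h. norm h < R \<Longrightarrow> \<bar>\<phi> (x + h) - \<phi> x - quad_poly g H h\<bar> \<le> \<eta>2 * R\<^sup>2 + \<eta>3 * R ^ 3"
    using quadratic_approx_ball[OF T less_imp_le[OF R(2)]] .
  have "\<bar>M - (\<phi> x + r\<^sup>2 * L)\<bar> \<le> (\<eta>2 * R\<^sup>2 + \<eta>3 * R ^ 3) + R ^ 3 * Z"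
    unfolding M_def L_def Z_def G_def
    by (rule mean_op_expansion[OF p g rb(2) R_def[unfolded \<gamma>_def] quadratic_approx_integrable[OF T R(2)] eR])
  also have "\<dots> = \<gamma>\<^sup>2 * \<eta>2 * r\<^sup>2 + \<gamma> ^ 3 * (Z + \<eta>3) * r ^ 3"
    by (simp add: R_def power_mult_distrib algebra_simps)
  also have "\<dots> \<le> \<gamma>\<^sup>2 * \<eta>2 * (\<epsilon>\<^sup>2 * c powr (- a)) + \<gamma> ^ 3 * (Z + \<eta>3) * (\<epsilon>\<^sup>2 * \<tau>)"
    using rb Z \<eta> \<gamma> by (intro add_mono mult_left_mono) auto
  finally have mean: "\<bar>M - (\<phi> x + r\<^sup>2 * L)\<bar> \<le> \<epsilon>\<^sup>2 * (c powr (- a) * (\<gamma>\<^sup>2 * \<eta>2) + \<gamma> ^ 3 * (Z + \<eta>3) * \<tau>)"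
    by (simp add: algebra_simps)
  have "A_plus_body p \<epsilon> \<phi> x c = a * S + (1 - a) * M"
    by (simp add: A_plus_body_def Let_def S_def M_def \<rho>_def r_def a_def)
  moreover have "\<epsilon>\<^sup>2 * young_fun a G L c = a * (\<rho> * G) + (1 - a) * (r\<^sup>2 * L)"
    unfolding rb(8) young_fun_def \<rho>_def by (simp add: algebra_simps)
  ultimately have eq: "A_plus_body p \<epsilon> \<phi> x c - (\<phi> x + \<epsilon>\<^sup>2 * young_fun a G L c)
     = a * (S - (\<phi> x + \<rho> * G)) + (1 - a) * (M - (\<phi> x + r\<^sup>2 * L))"
    by (simp add: algebra_simps)
  have "\<bar>A_plus_body p \<epsilon> \<phi> x c - (\<phi> x + \<epsilon>\<^sup>2 * young_fun a G L c)\<bar>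
      \<le> a * \<bar>S - (\<phi> x + \<rho> * G)\<bar> + (1 - a) * \<bar>M - (\<phi> x + r\<^sup>2 * L)\<bar>"
    unfolding eq using a by (intro order_trans[OF abs_triangle_ineq]) (simp add: abs_mult)
  also have "\<dots> \<le> a * (\<epsilon>\<^sup>2 * ((norm H / 2 + \<eta>2) * \<theta> + (Z + \<eta>3) * \<tau>))
      + (1 - a) * (\<epsilon>\<^sup>2 * (c powr (- a) * (\<gamma>\<^sup>2 * \<eta>2) + \<gamma> ^ 3 * (Z + \<eta>3) * \<tau>))"
    using a by (intro add_mono mult_left_mono sup mean) auto
  also have "\<dots> = \<epsilon>\<^sup>2 * (a * ((norm H / 2 + \<eta>2) * \<theta> + (Z + \<eta>3) * \<tau>)
      + (1 - a) * (\<gamma> ^ 3 * (Z + \<eta>3) * \<tau>) + (1 - a) * c powr (- a) * (\<gamma>\<^sup>2 * \<eta>2))"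
    by (simp add: algebra_simps)
  also have "\<dots> \<le> \<epsilon>\<^sup>2 * (1 * ((norm H / 2 + \<eta>2) * \<theta> + (Z + \<eta>3) * \<tau>)
      + 1 * (\<gamma> ^ 3 * (Z + \<eta>3) * \<tau>) + (1 - a) * c powr (- a) * (\<gamma>\<^sup>2 * \<eta>2))"
    using a \<gamma> Z \<eta> by (intro mult_left_mono add_mono mult_right_mono order_refl) (auto simp: \<theta>_def \<tau>_def)
  also have "1 * ((norm H / 2 + \<eta>2) * \<theta> + (Z + \<eta>3) * \<tau>) + 1 * (\<gamma> ^ 3 * (Z + \<eta>3) * \<tau>)
      = body_error p CARD('n) g H \<eta>2 \<eta>3 \<epsilon>"
    by (simp add: body_error_def \<theta>_def \<tau>_def Z_def G_def \<gamma>_def algebra_simps)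
  finally show ?thesis by (simp add: a_def G_def L_def)
qed

lemma young_fun_add:
  "young_fun a G (L + k) c = young_fun a G L c + (1 - a) * c powr (- a) * k"
  by (simp add: young_fun_def algebra_simps)

text \<open>The error term proportional to \<open>c\<^sup>-\<^sup>a\<close> has the form of the term with \<open>L\<close> in \<^const>\<open>young_fun\<close>, so
  it amounts to a shift of \<open>L\<close>.\<close>

lemma A_plus_body_bounds:
  fixes \<phi> :: "real^'n::finite \<Rightarrow> real" and p :: real
  defines "a \<equiv> alpha_const p" and "\<gamma> \<equiv> gamma_const p CARD('n)"
  assumes p: "p > 2" and g: "g \<noteq> 0" and T: "quadratic_approx \<phi> x g H \<delta> \<eta>2 \<eta>3"
    and \<epsilon>: "0 < \<epsilon>" "\<epsilon> < 1" "\<gamma> * m_eps p \<epsilon> < \<delta>" and c: "c \<in> {m_eps p \<epsilon>..M_eps p \<epsilon>}"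
  shows "\<phi> x + \<epsilon>\<^sup>2 * (young_fun a (norm g) (normalized_p_lap p g H - \<gamma>\<^sup>2 * \<eta>2) c
           - body_error p CARD('n) g H \<eta>2 \<eta>3 \<epsilon>) \<le> A_plus_body p \<epsilon> \<phi> x c"
    and "A_plus_body p \<epsilon> \<phi> x c \<le> \<phi> x + \<epsilon>\<^sup>2 * (young_fun a (norm g) (normalized_p_lap p g H + \<gamma>\<^sup>2 * \<eta>2) c
           + body_error p CARD('n) g H \<eta>2 \<eta>3 \<epsilon>)"
proof -
  define W where "W = (1 - a) * c powr (- a) * (\<gamma>\<^sup>2 * \<eta>2)"
  have Y: "young_fun a (norm g) (normalized_p_lap p g H - \<gamma>\<^sup>2 * \<eta>2) c = young_fun a (norm g) (normalized_p_lap p g H) c - W"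
    "young_fun a (norm g) (normalized_p_lap p g H + \<gamma>\<^sup>2 * \<eta>2) c = young_fun a (norm g) (normalized_p_lap p g H) c + W"
    using young_fun_add[of a "norm g" "normalized_p_lap p g H" "\<gamma>\<^sup>2 * \<eta>2" c]
      young_fun_add[of a "norm g" "normalized_p_lap p g H" "- (\<gamma>\<^sup>2 * \<eta>2)" c]
    by (simp_all add: W_def)
  have "\<bar>A_plus_body p \<epsilon> \<phi> x c - (\<phi> x + \<epsilon>\<^sup>2 * young_fun a (norm g) (normalized_p_lap p g H) c)\<bar>
      \<le> \<epsilon>\<^sup>2 * (body_error p CARD('n) g H \<eta>2 \<eta>3 \<epsilon> + W)"
    using A_plus_body_expansion[OF p g T \<epsilon>[unfolded \<gamma>_def] c] by (simp add: W_def a_def \<gamma>_def)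
  then show "\<phi> x + \<epsilon>\<^sup>2 * (young_fun a (norm g) (normalized_p_lap p g H - \<gamma>\<^sup>2 * \<eta>2) c
           - body_error p CARD('n) g H \<eta>2 \<eta>3 \<epsilon>) \<le> A_plus_body p \<epsilon> \<phi> x c"
    and "A_plus_body p \<epsilon> \<phi> x c \<le> \<phi> x + \<epsilon>\<^sup>2 * (young_fun a (norm g) (normalized_p_lap p g H + \<gamma>\<^sup>2 * \<eta>2) c
           + body_error p CARD('n) g H \<eta>2 \<eta>3 \<epsilon>)"
    unfolding Y abs_le_iff by (simp_all add: algebra_simps)
qed

lemma bdd_below_A_plus_body:
  fixes \<phi> :: "real^'n::finite \<Rightarrow> real" and p :: real
  assumes p: "p > 2" and g: "g \<noteq> 0" and T: "quadratic_approx \<phi> x g H \<delta> \<eta>2 \<eta>3"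
    and \<epsilon>: "0 < \<epsilon>" "\<epsilon> < 1" "gamma_const p CARD('n) * m_eps p \<epsilon> < \<delta>" and L: "normalized_p_lap p g H \<ge> 0"
  shows "bdd_below (A_plus_body p \<epsilon> \<phi> x ` {m_eps p \<epsilon>..M_eps p \<epsilon>})"
proof -
  define k where "k = (gamma_const p CARD('n))\<^sup>2 * \<eta>2"
  note a = alpha_const_bounds[OF p]
  have m: "m_eps p \<epsilon> > 0" using m_eps_le_M_eps[OF p \<epsilon>(1,2)] by simp
  have k: "k \<ge> 0" using T by (simp add: k_def quadratic_approx_def)
  have "\<phi> x + \<epsilon>\<^sup>2 * (- (m_eps p \<epsilon> powr (- alpha_const p) * k) - body_error p CARD('n) g H \<eta>2 \<eta>3 \<epsilon>)
      \<le> A_plus_body p \<epsilon> \<phi> x c" if c: "c \<in> {m_eps p \<epsilon>..M_eps p \<epsilon>}" for c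
  proof -
    have "(1 - alpha_const p) * c powr (- alpha_const p) * k
        \<le> 1 * m_eps p \<epsilon> powr (- alpha_const p) * k"
      using a m c k by (intro mult_mono powr_mono2') auto
    moreover have "0 \<le> young_fun (alpha_const p) (norm g) (normalized_p_lap p g H) c"
      using a L by (simp add: young_fun_def)
    ultimately have "- (m_eps p \<epsilon> powr (- alpha_const p) * k)
        \<le> young_fun (alpha_const p) (norm g) (normalized_p_lap p g H - k) c"
      using young_fun_add[of "alpha_const p" "norm g" "normalized_p_lap p g H" "- k" c] by simp
    then have "\<phi> x + \<epsilon>\<^sup>2 * (- (m_eps p \<epsilon> powr (- alpha_const p) * k) - body_error p CARD('n) g H \<eta>2 \<eta>3 \<epsilon>)
      \<le> \<phi> x + \<epsilon>\<^sup>2 * (young_fun (alpha_const p) (norm g) (normalized_p_lap p g H - k) c - body_error p CARD('n) g H \<eta>2 \<eta>3 \<epsilon>)"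
      by (intro add_left_mono mult_left_mono) auto
    also have "\<dots> \<le> A_plus_body p \<epsilon> \<phi> x c"
      using A_plus_body_bounds(1)[OF p g T \<epsilon> c] by (simp add: k_def)
    finally show ?thesis .
  qed
  then show ?thesis by (intro bdd_belowI2)
qed

lemma A_plus_well_defined:
  fixes \<phi> :: "real^'n::finite \<Rightarrow> real" and p :: real
  assumes p: "p > 2" and g: "g \<noteq> 0" and T: "quadratic_approx \<phi> x g H \<delta> \<eta>2 \<eta>3"
    and \<epsilon>: "0 < \<epsilon>" "\<epsilon> < 1" "gamma_const p CARD('n) * m_eps p \<epsilon> < \<delta>" and L: "normalized_p_lap p g H \<ge> 0"
    and U: "ball x \<delta> \<subseteq> U"
  shows "A_plus_well_defined p U \<epsilon> \<phi> x"
proof -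
  let ?\<gamma> = "gamma_const p CARD('n)"
  have wd: "ball x R \<noteq> {} \<and> ball x R \<subseteq> U \<and> bdd_above (\<phi> ` ball x R) \<and> bdd_below (\<phi> ` ball x R)
       \<and> set_integrable lborel (ball x R) \<phi>" if R: "0 < R" "R < \<delta>" for R
  proof -
    have e: "\<And>h. norm h < R \<Longrightarrow> \<bar>\<phi> (x + h) - \<phi> x - quad_poly g H h\<bar> \<le> \<eta>2 * R\<^sup>2 + \<eta>3 * R ^ 3"
      using quadratic_approx_ball[OF T less_imp_le[OF R(2)]] .
    have "ball x R \<subseteq> U" using R U subset_ball[of R \<delta> x] by auto
    then show ?thesis
      using R bdd_above_ball[OF g R(1) e] bdd_below_ball[OF g R(1) e] quadratic_approx_integrable[OF T R(2)] by auto
  qed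
  have \<gamma>: "?\<gamma> \<ge> 1" using gamma_const_ge_1[OF p] .
  have m: "m_eps p \<epsilon> > 0" using m_eps_le_M_eps[OF p \<epsilon>(1,2)] by simp
  have "ball x (\<epsilon>\<^sup>2 * c powr (1 - alpha_const p)) \<noteq> {} \<and> ball x (\<epsilon>\<^sup>2 * c powr (1 - alpha_const p)) \<subseteq> U
        \<and> bdd_above (\<phi> ` ball x (\<epsilon>\<^sup>2 * c powr (1 - alpha_const p)))
        \<and> mean_op_well_defined p U (\<epsilon> * c powr (- alpha_const p / 2)) \<phi> x"
    if c: "c \<in> {m_eps p \<epsilon>..M_eps p \<epsilon>}" for c
  proof -
    note rb = radius_bounds[OF p \<epsilon>(1,2) c]
    have "?\<gamma> * (\<epsilon> * c powr (- alpha_const p / 2)) \<le> ?\<gamma> * m_eps p \<epsilon>"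
      using \<gamma> rb(4) by (intro mult_left_mono) auto
    then have 1: "?\<gamma> * (\<epsilon> * c powr (- alpha_const p / 2)) < \<delta>" using \<epsilon>(3) by linarith
    have 2: "0 < ?\<gamma> * (\<epsilon> * c powr (- alpha_const p / 2))"
      using \<gamma> rb(2) \<epsilon>(1) by (intro mult_pos_pos) auto
    have 3: "\<epsilon>\<^sup>2 * c powr (1 - alpha_const p) < \<delta>"
      using rb(3) \<epsilon>(3) mult_right_mono[OF \<gamma>, of "m_eps p \<epsilon>"] m by linarith
    show ?thesis
      using wd[OF rb(1) 3] wd[OF 2 1] by (simp add: mean_op_well_defined_def Let_def)
  qed
  then show ?thesis
    using m_eps_le_M_eps[OF p \<epsilon>(1,2)] bdd_below_A_plus_body[OF p g T \<epsilon> L]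
    by (simp add: A_plus_well_defined_def Let_def)
qed

lemma A_plus_lower:
  fixes \<phi> :: "real^'n::finite \<Rightarrow> real" and p :: real
  assumes p: "p > 2" and g: "g \<noteq> 0" and T: "quadratic_approx \<phi> x g H \<delta> \<eta>2 \<eta>3"
    and \<epsilon>: "0 < \<epsilon>" "\<epsilon> < 1" "gamma_const p CARD('n) * m_eps p \<epsilon> < \<delta>"
    and L: "L = normalized_p_lap p g H - (gamma_const p CARD('n))\<^sup>2 * \<eta>2" "L \<ge> 0"
  shows "\<phi> x + \<epsilon>\<^sup>2 * (J p (norm g powr (p - 2) * L) - body_error p CARD('n) g H \<eta>2 \<eta>3 \<epsilon>) \<le> A_plus p \<epsilon> \<phi> x"
  unfolding A_plus_def
proof (rule cINF_greatest)
  fix c assume c: "c \<in> {m_eps p \<epsilon>..M_eps p \<epsilon>}"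
  have "c > 0" using c m_eps_le_M_eps[OF p \<epsilon>(1,2)] by simp
  then have "J p (norm g powr (p - 2) * L) \<le> young_fun (alpha_const p) (norm g) L c"
    using young_fun_ge[OF alpha_const_bounds[OF p], of "norm g" L c] L(2) g by (simp add: J_eq[OF p])
  then have "\<phi> x + \<epsilon>\<^sup>2 * (J p (norm g powr (p - 2) * L) - body_error p CARD('n) g H \<eta>2 \<eta>3 \<epsilon>)
      \<le> \<phi> x + \<epsilon>\<^sup>2 * (young_fun (alpha_const p) (norm g) L c - body_error p CARD('n) g H \<eta>2 \<eta>3 \<epsilon>)"
    by (intro add_left_mono mult_left_mono) auto
  also have "\<dots> \<le> A_plus_body p \<epsilon> \<phi> x c"
    using A_plus_body_bounds(1)[OF p g T \<epsilon> c] by (simp add: L(1))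
  finally show "\<phi> x + \<epsilon>\<^sup>2 * (J p (norm g powr (p - 2) * L) - body_error p CARD('n) g H \<eta>2 \<eta>3 \<epsilon>) \<le> A_plus_body p \<epsilon> \<phi> x c" .
qed (use m_eps_le_M_eps[OF p \<epsilon>(1,2)] in auto)

lemma A_plus_upper:
  fixes \<phi> :: "real^'n::finite \<Rightarrow> real" and p :: real
  assumes p: "p > 2" and g: "g \<noteq> 0" and T: "quadratic_approx \<phi> x g H \<delta> \<eta>2 \<eta>3"
    and \<epsilon>: "0 < \<epsilon>" "\<epsilon> < 1" "gamma_const p CARD('n) * m_eps p \<epsilon> < \<delta>" and L0: "normalized_p_lap p g H \<ge> 0"
    and c: "c \<in> {m_eps p \<epsilon>..M_eps p \<epsilon>}"
  shows "A_plus p \<epsilon> \<phi> x \<le> \<phi> x + \<epsilon>\<^sup>2 * (young_fun (alpha_const p) (norm g)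
     (normalized_p_lap p g H + (gamma_const p CARD('n))\<^sup>2 * \<eta>2) c + body_error p CARD('n) g H \<eta>2 \<eta>3 \<epsilon>)"
  unfolding A_plus_def
  using cINF_lower[OF bdd_below_A_plus_body[OF p g T \<epsilon> L0] c] A_plus_body_bounds(2)[OF p g T \<epsilon> c]
  by linarith

lemma A_plus_upper_pos:
  fixes \<phi> :: "real^'n::finite \<Rightarrow> real" and p :: real
  assumes p: "p > 2" and g: "g \<noteq> 0" and T: "quadratic_approx \<phi> x g H \<delta> \<eta>2 \<eta>3"
    and \<epsilon>: "0 < \<epsilon>" "\<epsilon> < 1" "gamma_const p CARD('n) * m_eps p \<epsilon> < \<delta>" and L0: "normalized_p_lap p g H \<ge> 0"
    and L: "L = normalized_p_lap p g H + (gamma_const p CARD('n))\<^sup>2 * \<eta>2" "L > 0"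
    and c: "L / norm g \<in> {m_eps p \<epsilon>..M_eps p \<epsilon>}"
  shows "A_plus p \<epsilon> \<phi> x \<le> \<phi> x + \<epsilon>\<^sup>2 * (J p (norm g powr (p - 2) * L) + body_error p CARD('n) g H \<eta>2 \<eta>3 \<epsilon>)"
  using A_plus_upper[OF p g T \<epsilon> L0 c] young_fun_argmin[OF alpha_const_bounds[OF p], of "norm g" L] g L(2)
  by (simp add: J_eq[OF p] flip: L(1))

text \<open>For \<open>L = 0\<close> the bracket \<open>a c\<^sup>1\<^sup>-\<^sup>a G\<close> is increasing in \<open>c\<close>, so the left endpoint is the best choice.\<close>

lemma A_plus_upper_zero:
  fixes \<phi> :: "real^'n::finite \<Rightarrow> real" and p :: real
  assumes p: "p > 2" and g: "g \<noteq> 0" and T: "quadratic_approx \<phi> x g H \<delta> 0 \<eta>3"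
    and \<epsilon>: "0 < \<epsilon>" "\<epsilon> < 1" "gamma_const p CARD('n) * m_eps p \<epsilon> < \<delta>" and L0: "normalized_p_lap p g H = 0"
  shows "A_plus p \<epsilon> \<phi> x \<le> \<phi> x + \<epsilon>\<^sup>2 * (norm g * \<epsilon> powr (2 / (3 * p - 4)) + body_error p CARD('n) g H 0 \<eta>3 \<epsilon>)"
proof -
  let ?m = "m_eps p \<epsilon>"
  have c: "?m \<in> {?m..M_eps p \<epsilon>}" using m_eps_le_M_eps[OF p \<epsilon>(1,2)] by simp
  have "young_fun (alpha_const p) (norm g) 0 ?m = alpha_const p * (norm g * \<epsilon> powr (2 / (3 * p - 4)))"
    by (simp add: young_fun_def m_eps_powers[OF p \<epsilon>(1)])
  also have "\<dots> \<le> 1 * (norm g * \<epsilon> powr (2 / (3 * p - 4)))"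
    using alpha_const_bounds[OF p] by (intro mult_right_mono) auto
  finally have "\<phi> x + \<epsilon>\<^sup>2 * (young_fun (alpha_const p) (norm g) 0 ?m + body_error p CARD('n) g H 0 \<eta>3 \<epsilon>)
     \<le> \<phi> x + \<epsilon>\<^sup>2 * (norm g * \<epsilon> powr (2 / (3 * p - 4)) + body_error p CARD('n) g H 0 \<eta>3 \<epsilon>)"
    by (intro add_left_mono mult_left_mono) auto
  with A_plus_upper[OF p g T \<epsilon> _ c] L0 show ?thesis by simp
qed

section \<open>Asymptotics of the averaging operator\<close>

lemma powr_small:
  assumes "0 < k" "0 < b" "0 < \<epsilon>" "\<epsilon> < b powr (1 / k)"
  shows "\<epsilon> powr k < (b::real)"
  using powr_less_mono2[of k \<epsilon> "b powr (1 / k)"] assms by (simp add: powr_powr)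

lemma eventually_powr_less:
  assumes "0 < k" "0 < (b::real)"
  shows "\<forall>\<^sub>F \<epsilon> in at_right 0. \<epsilon> powr k < b"
  using assms powr_small[OF assms] by (intro eventually_at_rightI[of 0 "b powr (1 / k)"]) auto

lemma eventually_eps_admissible:
  assumes p: "p > 2" and "\<delta> > 0" 
  shows "\<forall>\<^sub>F \<epsilon> in at_right 0. 0 < \<epsilon> \<and> \<epsilon> < 1 \<and> gamma_const p d * m_eps p \<epsilon> < \<delta>"
proof -
  have \<gamma>: "gamma_const p d > 0" using gamma_const_ge_1[OF p, of d] by linarith
  have "\<forall>\<^sub>F \<epsilon> in at_right (0::real). \<epsilon> \<in> {0<..<1}"
    by (rule eventually_at_right_real) simp
  moreover have "\<forall>\<^sub>F \<epsilon> in at_right 0. m_eps p \<epsilon> < \<delta> / gamma_const p d"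
    unfolding m_eps_eq[OF p] using p assms(2) \<gamma> by (intro eventually_powr_less) auto
  ultimately show ?thesis
    by eventually_elim (use \<gamma> in \<open>simp add: field_simps\<close>)
qed

lemma eventually_in_c_range:
  assumes p: "p > 2" and c: "c > 0"
  shows "\<forall>\<^sub>F \<epsilon> in at_right 0. c \<in> {m_eps p \<epsilon>..M_eps p \<epsilon>}"
proof -
  have "\<forall>\<^sub>F \<epsilon> in at_right 0. m_eps p \<epsilon> < c"
    unfolding m_eps_eq[OF p] using p c by (intro eventually_powr_less) auto
  moreover have "\<forall>\<^sub>F \<epsilon> in at_right 0. \<epsilon> powr (2 * (p - 1) / p) < 1 / c"
    using p c by (intro eventually_powr_less) auto
  moreover have "\<forall>\<^sub>F \<epsilon> in at_right (0::real). \<epsilon> \<in> {0<..<1}"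
    by (rule eventually_at_right_real) simp
  ultimately show ?thesis
    by eventually_elim (use c in \<open>simp add: M_eps_eq[OF p] powr_minus field_simps\<close>)
qed

lemma tendsto_powr_at_right_0:
  assumes "0 < (k::real)"
  shows "((\<lambda>\<epsilon>. \<epsilon> powr k) \<longlongrightarrow> 0) (at_right 0)"
  by (rule tendstoI) (use eventually_powr_less[OF assms] in \<open>simp add: dist_norm\<close>)

lemma body_error_tendsto_0:
  assumes "p > 2"
  shows "(body_error p d g H \<eta>2 \<eta>3 \<longlongrightarrow> 0) (at_right 0)"
proof -
  have "((\<lambda>\<epsilon>. \<epsilon> powr (2 * (p - 2) / p)) \<longlongrightarrow> 0) (at_right 0)"
    "((\<lambda>\<epsilon>. \<epsilon> powr (2 / (3 * p - 4))) \<longlongrightarrow> 0) (at_right 0)"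
    using assms by (auto intro!: tendsto_powr_at_right_0)
  then show ?thesis
    unfolding body_error_def[abs_def] by (auto intro!: tendsto_add_zero tendsto_mult_right_zero)
qed

text \<open>Given \<open>e\<close>, choose the shift \<open>\<kappa> = \<gamma>\<^sup>2 \<eta>\<close> so small that moving \<open>L\<close> by \<open>\<kappa>\<close> changes the signed power by
  less than \<open>e/2\<close>. The upper bound uses the parameter that is optimal for \<open>L + \<kappa>\<close>.\<close>

lemma A_plus_asymptotics:
  fixes \<phi> :: "real^'n::finite \<Rightarrow> real" and p :: real
  assumes p: "p > 2" and g: "g \<noteq> 0" and L: "normalized_p_lap p g H > 0"
    and T: "\<And>\<eta>. \<eta> > 0 \<Longrightarrow> \<exists>\<delta>>0. quadratic_approx \<phi> x g H \<delta> \<eta> 0"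
  shows "(\<lambda>\<epsilon>. A_plus p \<epsilon> \<phi> x - (\<phi> x + \<epsilon>\<^sup>2 * J p (norm g powr (p - 2) * normalized_p_lap p g H)))
     \<in> o[at_right 0](\<lambda>\<epsilon>. \<epsilon>\<^sup>2)"
proof (rule landau_o.smallI)
  fix e :: real assume e: "e > 0"
  define \<gamma> where "\<gamma> = gamma_const p CARD('n)"
  define L0 where "L0 = normalized_p_lap p g H"
  define F where "F k = J p (norm g powr (p - 2) * k)" for k
  have \<gamma>: "\<gamma> \<ge> 1" using gamma_const_ge_1[OF p] by (simp add: \<gamma>_def)
  have L0: "L0 > 0" using L by (simp add: L0_def)
  have "isCont (\<lambda>k. k powr (1 - alpha_const p) * norm g powr alpha_const p) L0"
    using L0 by (intro continuous_intros) auto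
  then obtain d where d: "d > 0" "\<And>k. dist k L0 < d \<Longrightarrow>
      dist (k powr (1 - alpha_const p) * norm g powr alpha_const p) (L0 powr (1 - alpha_const p) * norm g powr alpha_const p) < e / 2"
    using half_gt_zero[OF e] unfolding continuous_at_eps_delta by blast
  have F: "\<bar>F k - F L0\<bar> < e / 2" if "k \<ge> 0" "\<bar>k - L0\<bar> < d" for k
    using d(2)[of k] that g L0 by (simp add: F_def J_eq[OF p] dist_norm)
  \<comment> \<open>The bound by \<open>L0\<close> keeps \<open>L0 - \<kappa>\<close> nonnegative, as the lower bound for the infimum requires.\<close>
  define \<kappa> where "\<kappa> = min (d / 2) L0"
  define \<eta> where "\<eta> = \<kappa> / \<gamma>\<^sup>2"
  have \<kappa>: "\<kappa> > 0" "\<kappa> < d" "\<kappa> \<le> L0" using d(1) L0 by (auto simp: \<kappa>_def)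
  have \<eta>: "\<eta> > 0" "\<gamma>\<^sup>2 * \<eta> = \<kappa>" using \<kappa>(1) \<gamma> by (auto simp: \<eta>_def)
  obtain \<delta> where \<delta>: "\<delta> > 0" and T': "quadratic_approx \<phi> x g H \<delta> \<eta> 0" using T[OF \<eta>(1)] by blast
  have "\<forall>\<^sub>F \<epsilon> in at_right 0. body_error p CARD('n) g H \<eta> 0 \<epsilon> < e / 2"
    using order_tendstoD(2)[OF body_error_tendsto_0[OF p], of "e / 2"] e by simp
  moreover have "\<forall>\<^sub>F \<epsilon> in at_right 0. (L0 + \<kappa>) / norm g \<in> {m_eps p \<epsilon>..M_eps p \<epsilon>}"
    using L0 \<kappa> g by (intro eventually_in_c_range[OF p]) auto
  ultimately show "\<forall>\<^sub>F \<epsilon> in at_right 0.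
      norm (A_plus p \<epsilon> \<phi> x - (\<phi> x + \<epsilon>\<^sup>2 * J p (norm g powr (p - 2) * normalized_p_lap p g H))) \<le> e * norm (\<epsilon>\<^sup>2)"
    using eventually_eps_admissible[OF p \<delta>, of "CARD('n)"]
  proof eventually_elim
    case (elim \<epsilon>)
    let ?B = "body_error p CARD('n) g H \<eta> 0 \<epsilon>"
    have \<epsilon>: "0 < \<epsilon>" "\<epsilon> < 1" "gamma_const p CARD('n) * m_eps p \<epsilon> < \<delta>" using elim by auto
    have F1: "\<bar>F (L0 - \<kappa>) - F L0\<bar> < e / 2" and F2: "\<bar>F (L0 + \<kappa>) - F L0\<bar> < e / 2"
      using \<kappa> L0 by (intro F; simp)+
    have "\<phi> x + \<epsilon>\<^sup>2 * (F (L0 - \<kappa>) - ?B) \<le> A_plus p \<epsilon> \<phi> x"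
      unfolding F_def
      by (rule A_plus_lower[OF p g T' \<epsilon>]) (use \<eta> \<kappa> in \<open>simp_all add: \<gamma>_def L0_def\<close>)
    moreover have "\<epsilon>\<^sup>2 * (F L0 - e) \<le> \<epsilon>\<^sup>2 * (F (L0 - \<kappa>) - ?B)"
      using F1 elim(1) unfolding abs_less_iff by (intro mult_left_mono) (linarith, simp)
    moreover have "A_plus p \<epsilon> \<phi> x \<le> \<phi> x + \<epsilon>\<^sup>2 * (F (L0 + \<kappa>) + ?B)"
      unfolding F_def
      by (rule A_plus_upper_pos[OF p g T' \<epsilon>])
         (use \<eta> \<kappa> L0 elim(2) in \<open>simp_all add: \<gamma>_def L0_def\<close>)
    moreover have "\<epsilon>\<^sup>2 * (F (L0 + \<kappa>) + ?B) \<le> \<epsilon>\<^sup>2 * (F L0 + e)"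
      using F2 elim(1) unfolding abs_less_iff by (intro mult_left_mono) (linarith, simp)
    ultimately show ?case
      by (simp add: F_def L0_def abs_le_iff algebra_simps)
  qed
qed

text \<open>With a purely cubic remainder there is no shift of \<open>L\<close>, so the infimum inherits the uniform
  error. The term with \<open>|g|\<close> accounts for the missing minimiser when \<open>L = 0\<close>.\<close>

lemma A_plus_rate:
  fixes \<phi> :: "real^'n::finite \<Rightarrow> real" and p :: real
  assumes p: "p > 2" and g: "g \<noteq> 0" and T: "quadratic_approx \<phi> x g H \<delta> 0 \<eta>3"
    and \<epsilon>: "0 < \<epsilon>" "\<epsilon> < 1" "gamma_const p CARD('n) * m_eps p \<epsilon> < \<delta>"
    and L: "normalized_p_lap p g H \<ge> 0"
    and c: "normalized_p_lap p g H > 0 \<Longrightarrow> normalized_p_lap p g H / norm g \<in> {m_eps p \<epsilon>..M_eps p \<epsilon>}"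
  shows "\<bar>A_plus p \<epsilon> \<phi> x - (\<phi> x + \<epsilon>\<^sup>2 * J p (norm g powr (p - 2) * normalized_p_lap p g H))\<bar>
     \<le> \<epsilon>\<^sup>2 * (norm g * \<epsilon> powr (2 / (3 * p - 4)) + body_error p CARD('n) g H 0 \<eta>3 \<epsilon>)"
proof -
  let ?J = "J p (norm g powr (p - 2) * normalized_p_lap p g H)"
  let ?B = "body_error p CARD('n) g H 0 \<eta>3 \<epsilon>"
  have t: "0 \<le> \<epsilon>\<^sup>2 * (norm g * \<epsilon> powr (2 / (3 * p - 4)))" by simp
  have lo: "\<phi> x + \<epsilon>\<^sup>2 * (?J - ?B) \<le> A_plus p \<epsilon> \<phi> x"
    using A_plus_lower[OF p g T \<epsilon> refl] L by simp
  have hi: "A_plus p \<epsilon> \<phi> x \<le> \<phi> x + \<epsilon>\<^sup>2 * (?J + norm g * \<epsilon> powr (2 / (3 * p - 4)) + ?B)"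
  proof (cases "normalized_p_lap p g H = 0")
    case True
    then show ?thesis using A_plus_upper_zero[OF p g T \<epsilon> True] by (simp add: J_def)
  next
    case False
    then have "normalized_p_lap p g H > 0" using L by simp
    with A_plus_upper_pos[OF p g T \<epsilon> L refl] c have "A_plus p \<epsilon> \<phi> x \<le> \<phi> x + \<epsilon>\<^sup>2 * (?J + ?B)"
      by simp
    with t show ?thesis unfolding distrib_left by linarith
  qed
  show ?thesis using lo hi t unfolding abs_le_iff distrib_left right_diff_distrib by linarith
qed

section \<open>Reflection\<close>

lemma mean_op_minus: "mean_op p r (\<lambda>y. - \<phi> y) x = - mean_op p r \<phi> x"
proof -
  have "(SUP y\<in>A. - \<phi> y) = - (INF y\<in>A. \<phi> y)" "(INF y\<in>A. - \<phi> y) = - (SUP y\<in>A. \<phi> y)" for A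
    using Inf_eq_minus_Sup[of \<phi> A] Inf_eq_minus_Sup[of "\<lambda>y. - \<phi> y" A] by simp_all
  moreover have "(LINT y:A|lborel. - \<phi> y) = - (LINT y:A|lborel. \<phi> y)" for A
    by (simp add: set_lebesgue_integral_def)
  ultimately show ?thesis by (simp only: mean_op_def Let_def) (simp add: algebra_simps)
qed

lemma A_minus_body_eq: "A_minus_body p \<epsilon> \<phi> x c = - A_plus_body p \<epsilon> (\<lambda>y. - \<phi> y) x c"
  using Inf_eq_minus_Sup[of \<phi> "ball x (\<epsilon>\<^sup>2 * c powr (1 - alpha_const p))"]
  by (simp add: A_minus_body_def A_plus_body_def Let_def mean_op_minus algebra_simps)

lemma A_minus_eq: "A_minus p \<epsilon> \<phi> x = - A_plus p \<epsilon> (\<lambda>y. - \<phi> y) x"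
  using Inf_eq_minus_Sup[of "A_plus_body p \<epsilon> (\<lambda>y. - \<phi> y) x" "{m_eps p \<epsilon>..M_eps p \<epsilon>}"]
  by (simp add: A_minus_def A_plus_def A_minus_body_eq)

lemma mean_op_well_defined_minus:
  "mean_op_well_defined p U r (\<lambda>y. - \<phi> y) x \<longleftrightarrow> mean_op_well_defined p U r \<phi> x"
proof -
  have "set_integrable lborel B (\<lambda>y. - \<phi> y) \<longleftrightarrow> set_integrable lborel B \<phi>" for B
    by (simp add: set_integrable_def)
  moreover have "bdd_below ((\<lambda>y. - \<phi> y) ` B) \<longleftrightarrow> bdd_above (\<phi> ` B)" for B
    using bdd_above_uminus_image[of "\<lambda>y. - \<phi> y" B] by simp
  moreover have "bdd_above ((\<lambda>y. - \<phi> y) ` B) \<longleftrightarrow> bdd_below (\<phi> ` B)" for B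
    by (rule bdd_above_uminus_image)
  ultimately show ?thesis unfolding mean_op_well_defined_def Let_def by metis
qed

lemma A_minus_well_defined_iff:
  "A_minus_well_defined p U \<epsilon> \<phi> x \<longleftrightarrow> A_plus_well_defined p U \<epsilon> (\<lambda>y. - \<phi> y) x"
  unfolding A_minus_well_defined_def A_plus_well_defined_def Let_def A_minus_body_eq
    mean_op_well_defined_minus
  by (simp only: bdd_above_uminus_image)

lemma normalized_p_lap_minus: "normalized_p_lap p (- g) (- H) = - normalized_p_lap p g H"
  by (simp add: normalized_p_lap_def dir_second_deriv_minus trace_def sum_negf)

lemma J_minus: "J p (- \<xi>) = - J p \<xi>"
  by (auto simp: J_def)

section \<open>Taylor expansion and the p-Laplacian\<close>

lemma C_on_Suc_imp: "C_on (Suc k) S f \<Longrightarrow> C_on k S f"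
proof (induction k arbitrary: f)
  case 0
  then show ?case
    by (auto intro!: continuous_at_imp_continuous_on differentiable_imp_continuous_within)
next
  case (Suc k)
  then show ?case by (metis C_on.simps(2))
qed

lemma C_on_3_imp_2: "C_on 3 S f \<Longrightarrow> C_on 2 S f"
  using C_on_Suc_imp[of 2 S f] by (simp only: Suc_numeral Num.add_num_simps)

text \<open>Total differentiability turns the partial derivatives, which are all that the class \<open>C\<^sup>k\<close> is
  defined with, into derivatives along arbitrary lines.\<close>

lemma frechet_derivative_eq_sum:
  fixes f :: "real^'n::finite \<Rightarrow> real"
  assumes "f differentiable (at y)"
  shows "frechet_derivative f (at y) h = (\<Sum>i\<in>UNIV. h $ i * partial_deriv i f y)"
proof -
  have lin: "linear (frechet_derivative f (at y))"
    using assms by (rule linear_frechet_derivative)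
  have "h = (\<Sum>i\<in>UNIV. h $ i *\<^sub>R axis i 1)"
    by (simp add: vec_eq_iff axis_def if_distrib sum.delta cong: if_cong)
  then have "frechet_derivative f (at y) h = frechet_derivative f (at y) (\<Sum>i\<in>UNIV. h $ i *\<^sub>R axis i 1)"
    by simp
  also have "\<dots> = (\<Sum>i\<in>UNIV. h $ i * partial_deriv i f y)"
    by (simp add: linear_sum[OF lin] linear_cmul[OF lin] partial_deriv_def)
  finally show ?thesis .
qed

lemma DERIV_along_line:
  fixes f :: "real^'n::finite \<Rightarrow> real"
  assumes "f differentiable (at (x + t *\<^sub>R h))"
  shows "((\<lambda>t. f (x + t *\<^sub>R h)) has_real_derivative
           (\<Sum>i\<in>UNIV. h $ i * partial_deriv i f (x + t *\<^sub>R h))) (at t)"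
proof -
  have line: "((\<lambda>t. x + t *\<^sub>R h) has_derivative (\<lambda>s. s *\<^sub>R h)) (at t)"
    by (auto intro!: derivative_eq_intros)
  have "(f has_derivative frechet_derivative f (at (x + t *\<^sub>R h))) (at (x + t *\<^sub>R h))"
    using assms by (simp add: frechet_derivative_works)
  from has_derivative_compose[OF line this]
  have "((\<lambda>t. f (x + t *\<^sub>R h)) has_derivative (\<lambda>s. frechet_derivative f (at (x + t *\<^sub>R h)) (s *\<^sub>R h))) (at t)" .
  then show ?thesis
    unfolding has_field_derivative_def frechet_derivative_eq_sum[OF assms]
    by (rule has_derivative_eq_rhs) (simp add: fun_eq_iff sum_distrib_left sum_distrib_right mult_ac)
qed

lemma line_in_ball:
  assumes "norm (h::'a::real_normed_vector) < r" "0 \<le> t" "t \<le> 1"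
  shows "x + t *\<^sub>R h \<in> ball x r"
proof -
  have "\<bar>t\<bar> * norm h \<le> 1 * norm h" using assms by (intro mult_right_mono) auto
  then show ?thesis using assms by (simp add: dist_norm)
qed

text \<open>The first three derivatives of \<open>t \<mapsto> \<phi>(y + t h)\<close> at \<open>t = 0\<close>, nested in the order in which
  differentiation along the line produces them.\<close>

definition line_deriv1 where "line_deriv1 \<phi> h y = (\<Sum>i\<in>UNIV. h $ i * partial_deriv i \<phi> y)"
definition line_deriv2 where "line_deriv2 \<phi> h y = (\<Sum>j\<in>UNIV. h $ j * (\<Sum>i\<in>UNIV. h $ i * partial_deriv i (partial_deriv j \<phi>) y))"
definition line_deriv3 where "line_deriv3 \<phi> h y = (\<Sum>k\<in>UNIV. h $ k * (\<Sum>j\<in>UNIV. h $ j *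
   (\<Sum>i\<in>UNIV. h $ i * partial_deriv i (partial_deriv j (partial_deriv k \<phi>)) y)))"

lemma line_deriv1_eq: "line_deriv1 \<phi> h y = gradient \<phi> y \<bullet> h"
  by (simp add: line_deriv1_def gradient_def inner_vec_def mult.commute)

lemma line_deriv2_eq: "line_deriv2 \<phi> h y = h \<bullet> (hessian \<phi> y *v h)"
  unfolding line_deriv2_def
  by (simp add: hessian_def inner_vec_def matrix_vector_mult_def sum_distrib_left mult_ac)
     (subst sum.swap, simp add: mult_ac)

lemma abs_line_deriv3_le: "\<bar>line_deriv3 \<phi> h y\<bar> \<le> norm (third_deriv \<phi> y) * norm h ^ 3"
proof -
  let ?T = "third_deriv \<phi> y"
  let ?C = "\<Sum>i\<in>UNIV. h $ i *\<^sub>R ?T $ i"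
  let ?C' = "\<Sum>j\<in>UNIV. h $ j *\<^sub>R ?C $ j"
  have "line_deriv3 \<phi> h y = (\<Sum>k\<in>UNIV. h $ k *\<^sub>R ?C' $ k)"
  proof -
    have "(\<Sum>k\<in>UNIV. h $ k *\<^sub>R ?C' $ k) = (\<Sum>k\<in>UNIV. \<Sum>j\<in>UNIV. \<Sum>i\<in>UNIV. h $ k * (h $ j * (h $ i * ?T $ i $ j $ k)))"
      by (simp add: sum_distrib_left)
    also have "\<dots> = line_deriv3 \<phi> h y"
      by (simp add: line_deriv3_def third_deriv_def sum_distrib_left)
    finally show ?thesis ..
  qed
  also have "\<bar>\<dots>\<bar> \<le> norm h * norm ?C'"
    using norm_contraction_le[of h ?C'] by simp
  also have "\<dots> \<le> norm h * (norm h * norm ?C)"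
    by (intro mult_left_mono norm_contraction_le) simp
  also have "\<dots> \<le> norm h * (norm h * (norm h * norm ?T))"
    by (intro mult_left_mono norm_contraction_le) simp_all
  finally show ?thesis by (simp add: power3_eq_cube mult_ac)
qed

lemma DERIV_line_deriv1:
  assumes "C_on 2 S \<phi>" "x + t *\<^sub>R h \<in> S"
  shows "((\<lambda>t. \<phi> (x + t *\<^sub>R h)) has_real_derivative line_deriv1 \<phi> h (x + t *\<^sub>R h)) (at t)"
    "((\<lambda>t. line_deriv1 \<phi> h (x + t *\<^sub>R h)) has_real_derivative line_deriv2 \<phi> h (x + t *\<^sub>R h)) (at t)"
proof -
  have d: "\<phi> differentiable (at (x + t *\<^sub>R h))"
    "\<And>j. partial_deriv j \<phi> differentiable (at (x + t *\<^sub>R h))"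
    using assms by (auto simp: numeral_2_eq_2)
  show "((\<lambda>t. \<phi> (x + t *\<^sub>R h)) has_real_derivative line_deriv1 \<phi> h (x + t *\<^sub>R h)) (at t)"
    unfolding line_deriv1_def by (rule DERIV_along_line[OF d(1)])
  show "((\<lambda>t. line_deriv1 \<phi> h (x + t *\<^sub>R h)) has_real_derivative line_deriv2 \<phi> h (x + t *\<^sub>R h)) (at t)"
    unfolding line_deriv1_def line_deriv2_def by (intro DERIV_sum DERIV_cmult DERIV_along_line d)
qed

lemma DERIV_line_deriv2:
  assumes "C_on 3 S \<phi>" "x + t *\<^sub>R h \<in> S"
  shows "((\<lambda>t. line_deriv2 \<phi> h (x + t *\<^sub>R h)) has_real_derivative line_deriv3 \<phi> h (x + t *\<^sub>R h)) (at t)"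
proof -
  have d: "\<And>i j. partial_deriv i (partial_deriv j \<phi>) differentiable (at (x + t *\<^sub>R h))"
    using assms by (auto simp: numeral_3_eq_3)
  show ?thesis
    unfolding line_deriv2_def line_deriv3_def by (intro DERIV_sum DERIV_cmult DERIV_along_line d)
qed

lemma taylor_order_2:
  assumes C: "C_on 2 (ball x r) \<phi>" and h: "norm h < r"
  obtains t where "0 < t" "t < 1" "\<phi> (x + h) = \<phi> x + line_deriv1 \<phi> h x + line_deriv2 \<phi> h (x + t *\<^sub>R h) / 2"
proof -
  define diff where "diff m t = (if m = 0 then \<phi> (x + t *\<^sub>R h) else if m = 1 then line_deriv1 \<phi> h (x + t *\<^sub>R h)
    else line_deriv2 \<phi> h (x + t *\<^sub>R h))" for m :: nat and t :: real
  have "\<exists>t>0. t < 1 \<and> diff 0 1 = (\<Sum>m<2. diff m 0 / fact m * 1 ^ m) + diff 2 t / fact 2 * 1 ^ 2"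
  proof (rule Maclaurin)
    show "\<forall>m t. m < 2 \<and> 0 \<le> t \<and> t \<le> 1 \<longrightarrow> (diff m has_real_derivative diff (Suc m) t) (at t)"
      using DERIV_line_deriv1[OF C line_in_ball[OF h]] by (auto simp: diff_def[abs_def] less_2_cases_iff)
  qed auto
  then show ?thesis using that by (auto simp: diff_def lessThan_nat_numeral numeral_2_eq_2)
qed

lemma taylor_order_3:
  assumes C: "C_on 3 (ball x r) \<phi>" and h: "norm h < r"
  obtains t where "0 < t" "t < 1" "\<phi> (x + h) = \<phi> x + line_deriv1 \<phi> h x + line_deriv2 \<phi> h x / 2 + line_deriv3 \<phi> h (x + t *\<^sub>R h) / 6"
proof -
  have C2: "C_on 2 (ball x r) \<phi>" using C by (rule C_on_3_imp_2)
  define diff where "diff m t = (if m = 0 then \<phi> (x + t *\<^sub>R h) else if m = 1 then line_deriv1 \<phi> h (x + t *\<^sub>R h)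
    else if m = 2 then line_deriv2 \<phi> h (x + t *\<^sub>R h) else line_deriv3 \<phi> h (x + t *\<^sub>R h))" for m :: nat and t :: real
  have "\<exists>t>0. t < 1 \<and> diff 0 1 = (\<Sum>m<3. diff m 0 / fact m * 1 ^ m) + diff 3 t / fact 3 * 1 ^ 3"
  proof (rule Maclaurin)
    have "m = 0 \<or> m = 1 \<or> m = 2" if "m < 3" for m :: nat using that by auto
    then show "\<forall>m t. m < 3 \<and> 0 \<le> t \<and> t \<le> 1 \<longrightarrow> (diff m has_real_derivative diff (Suc m) t) (at t)"
      using DERIV_line_deriv1[OF C2 line_in_ball[OF h]] DERIV_line_deriv2[OF C line_in_ball[OF h]]
      by (fastforce simp: diff_def[abs_def])
  qed auto
  then show ?thesis using that by (auto simp: diff_def eval_nat_numeral)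
qed

lemma continuous_on_hessian: "C_on 2 S \<phi> \<Longrightarrow> continuous_on S (hessian \<phi>)"
  unfolding hessian_def[abs_def] by (auto simp: numeral_2_eq_2 intro!: continuous_intros)

lemma continuous_on_third_deriv: "C_on 3 S \<phi> \<Longrightarrow> continuous_on S (third_deriv \<phi>)"
  unfolding third_deriv_def[abs_def] by (auto simp: numeral_3_eq_3 intro!: continuous_intros)

lemma continuous_on_gradient: "C_on 2 S \<phi> \<Longrightarrow> continuous_on S (gradient \<phi>)"
  unfolding gradient_def[abs_def]
  by (intro continuous_on_vec_lambda continuous_at_imp_continuous_on)
     (auto simp: numeral_2_eq_2 intro: differentiable_imp_continuous_within)

text \<open>The product rule for \<open>|\<nabla>\<phi>|\<^sup>p\<^sup>-\<^sup>2 \<partial>\<^sub>i\<phi>\<close>. Writing \<open>|\<nabla>\<phi>|\<^sup>p\<^sup>-\<^sup>2\<close> as the power \<open>q = (p - 2)/2\<close> of the sum of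
  squares \<open>s\<close> avoids differentiating the norm.\<close>

lemma p_laplacian_eq:
  fixes \<phi> :: "real^'n::finite \<Rightarrow> real"
  assumes C: "C_on 2 S \<phi>" "x \<in> S" and g: "gradient \<phi> x \<noteq> 0"
  shows "p_laplacian p \<phi> x = norm (gradient \<phi> x) powr (p - 2) * normalized_p_lap p (gradient \<phi> x) (hessian \<phi> x)"
proof -
  define g where "g = gradient \<phi> x"
  define H where "H = hessian \<phi> x"
  define s where "s z = (\<Sum>j\<in>UNIV. (partial_deriv j \<phi> z)\<^sup>2)" for z
  define q where "q = (p - 2) / 2"
  define D where "D j = frechet_derivative (partial_deriv j \<phi>) (at x)" for j
  have G: "norm g > 0" using g by (simp add: g_def)
  have gj: "g $ j = partial_deriv j \<phi> x" for j by (simp add: g_def gradient_def)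
  have sqrt_s: "norm (gradient \<phi> z) = sqrt (s z)" for z
    by (simp add: norm_vec_def L2_set_def s_def gradient_def)
  have s_nonneg: "s z \<ge> 0" for z by (simp add: s_def sum_nonneg)
  have sx: "s x = (norm g)\<^sup>2" by (simp add: g_def sqrt_s s_nonneg)
  have sx0: "s x > 0" using G by (simp add: sx)
  have q2: "2 * q = p - 2" by (simp add: q_def)
  have sq: "s x powr e = norm g powr (2 * e)" for e
    by (subst powr_powr[symmetric]) (use G in \<open>simp add: sx\<close>)
  have D: "(partial_deriv j \<phi> has_derivative D j) (at x)" for j
    using C by (auto simp: numeral_2_eq_2 D_def frechet_derivative_works)
  have Dax: "D j (axis i 1) = H $ i $ j" for i j
    by (simp add: D_def H_def hessian_def partial_deriv_def)
  have ds: "(s has_derivative (\<lambda>h. \<Sum>j\<in>UNIV. 2 * g $ j * D j h)) (at x)"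
    unfolding s_def[abs_def]
    by (auto intro!: derivative_eq_intros D simp: gj mult_ac)
  have dpow: "((\<lambda>z. s z powr q) has_derivative (\<lambda>h. (\<Sum>j\<in>UNIV. 2 * g $ j * D j h) * (q * s x powr (q - 1)))) (at x)"
    by (rule DERIV_compose_FDERIV[OF _ ds, where f = "\<lambda>t. t powr q"])
       (rule has_real_derivative_powr[OF sx0])
  have pd: "partial_deriv i (\<lambda>z. s z powr q * partial_deriv i \<phi> z) x
      = s x powr q * H $ i $ i + (\<Sum>j\<in>UNIV. 2 * g $ j * H $ i $ j) * (q * s x powr (q - 1)) * g $ i" for i
  proof -
    have "((\<lambda>z. s z powr q * partial_deriv i \<phi> z) has_derivative
      (\<lambda>h. s x powr q * D i h + (\<Sum>j\<in>UNIV. 2 * g $ j * D j h) * (q * s x powr (q - 1)) * g $ i)) (at x)"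
      using has_derivative_mult[OF dpow D[of i]] by (simp add: gj)
    from frechet_derivative_at[OF this, symmetric] show ?thesis
      by (simp add: partial_deriv_def[of i "\<lambda>z. s z powr q * partial_deriv i \<phi> z"] Dax)
  qed
  \<comment> \<open>At zeros of the gradient both sides vanish by the convention \<open>0 powr q = 0\<close>, so this is an
    identity of functions and can be used under the derivative.\<close>
  have "norm (gradient \<phi> z) powr (p - 2) = s z powr q" for z
    using s_nonneg[of z] by (simp add: sqrt_s q_def powr_half_sqrt[symmetric] powr_powr)
  then have "p_laplacian p \<phi> x = (\<Sum>i\<in>UNIV. partial_deriv i (\<lambda>z. s z powr q * partial_deriv i \<phi> z) x)"
    by (simp add: p_laplacian_def divergence_def gradient_def)
  also have "\<dots> = s x powr q * trace H + (2 * q * s x powr (q - 1)) * (g \<bullet> (H *v g))"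
    unfolding pd
    by (simp add: sum.distrib trace_def inner_vec_def matrix_vector_mult_def sum_distrib_left sum_distrib_right mult_ac)
  also have "s x powr q = norm g powr (p - 2)"
    unfolding sq q2 ..
  also note q2
  also have "s x powr (q - 1) = norm g powr (p - 2) / (norm g)\<^sup>2"
  proof -
    have "s x powr (q - 1) = norm g powr (2 * (q - 1))"
      by (rule sq)
    also have "2 * (q - 1) = (p - 2) - 2" using q2 by simp
    finally show ?thesis using G by (simp add: powr_diff powr_realpow)
  qed
  also have "g \<bullet> (H *v g) = (norm g)\<^sup>2 * dir_second_deriv g H"
  proof -
    have "g \<bullet> (H *v g) = (norm g *\<^sub>R sgn g) \<bullet> (H *v (norm g *\<^sub>R sgn g))"
      using G by (simp add: sgn_div_norm)
    also have "\<dots> = (norm g)\<^sup>2 * dir_second_deriv g H"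
      by (simp only: dir_second_deriv_def matrix_vector_mult_scaleR) (simp add: power2_eq_square)
    finally show ?thesis .
  qed
  finally have "p_laplacian p \<phi> x = norm g powr (p - 2) * trace H
     + (p - 2) * (norm g powr (p - 2) / (norm g)\<^sup>2) * ((norm g)\<^sup>2 * dir_second_deriv g H)" .
  also have "(p - 2) * (norm g powr (p - 2) / (norm g)\<^sup>2) * ((norm g)\<^sup>2 * dir_second_deriv g H)
     = norm g powr (p - 2) * ((p - 2) * dir_second_deriv g H)"
    using G by simp
  finally show ?thesis
    unfolding normalized_p_lap_def g_def[symmetric] H_def[symmetric] by (simp only: distrib_left add.commute)
qed

text \<open>Taylor's formula with Lagrange remainder contains the Hessian at an intermediate point, which is
  close to the one at \<open>x\<close>.\<close>

lemma quadratic_approx_of_C2: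
  fixes \<phi> :: "real^'n::finite \<Rightarrow> real"
  assumes C: "C_on 2 (ball x r) \<phi>" and r: "r > 0" and \<eta>: "\<eta> > 0"
  obtains \<delta> where "0 < \<delta>" "\<delta> \<le> r" "quadratic_approx \<phi> x (gradient \<phi> x) (hessian \<phi> x) \<delta> \<eta> 0"
proof -
  let ?H = "hessian \<phi>"
  have "isCont ?H x"
    using continuous_on_hessian[OF C] r by (simp add: continuous_on_eq_continuous_at)
  then obtain \<delta>0 where \<delta>0: "\<delta>0 > 0" "\<And>y. dist y x < \<delta>0 \<Longrightarrow> dist (?H y) (?H x) < \<eta>"
    using \<eta> unfolding continuous_at_eps_delta by blast
  define \<delta> where "\<delta> = min \<delta>0 r"
  have "\<bar>\<phi> (x + h) - \<phi> x - quad_poly (gradient \<phi> x) (?H x) h\<bar> \<le> \<eta> * (norm h)\<^sup>2" if h: "norm h < \<delta>" for h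
  proof -
    have "norm h < r" using h by (simp add: \<delta>_def)
    from taylor_order_2[OF C this] obtain t where t: "0 < t" "t < 1"
      "\<phi> (x + h) = \<phi> x + line_deriv1 \<phi> h x + line_deriv2 \<phi> h (x + t *\<^sub>R h) / 2" by blast
    have "x + t *\<^sub>R h \<in> ball x \<delta>" using t by (intro line_in_ball[OF h]) auto
    then have "norm (?H (x + t *\<^sub>R h) - ?H x) \<le> \<eta>"
      using \<delta>0(2)[of "x + t *\<^sub>R h"] by (simp add: \<delta>_def dist_norm)
    then have "norm (?H (x + t *\<^sub>R h) - ?H x) * norm h * norm h \<le> \<eta> * norm h * norm h"
      by (intro mult_right_mono) auto
    moreover have "\<phi> (x + h) - \<phi> x - quad_poly (gradient \<phi> x) (?H x) h
      = (h \<bullet> ((?H (x + t *\<^sub>R h) - ?H x) *v h)) / 2"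
      by (simp add: t(3) line_deriv1_eq line_deriv2_eq quad_poly_def matrix_vector_mult_diff_rdistrib inner_diff_right diff_divide_distrib)
    ultimately show ?thesis
      using inner_matrix_le[of h "?H (x + t *\<^sub>R h) - ?H x" h] \<eta> by (simp add: power2_eq_square)
  qed
  moreover have "continuous_on (ball x \<delta>) \<phi>"
    using C_on_Suc_imp[of 0 "ball x r" \<phi>] C_on_Suc_imp[of 1 "ball x r" \<phi>] C
    by (auto simp: numeral_2_eq_2 \<delta>_def intro: continuous_on_subset)
  ultimately have "quadratic_approx \<phi> x (gradient \<phi> x) (hessian \<phi> x) \<delta> \<eta> 0"
    using \<eta> by (simp add: quadratic_approx_def)
  then show ?thesis using that[of \<delta>] \<delta>0(1) r by (simp add: \<delta>_def)
qed

text \<open>Near \<open>x\<close> the third derivatives exceed \<open>|T|\<close> by at most the positive number \<open>|g|\<close>. This choice of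
  the slack makes it part of the error bound of the theorem.\<close>

lemma quadratic_approx_of_C3:
  fixes \<phi> :: "real^'n::finite \<Rightarrow> real"
  assumes C: "C_on 3 (ball x r) \<phi>" and r: "r > 0" and g: "gradient \<phi> x \<noteq> 0"
  obtains \<delta> where "0 < \<delta>" "\<delta> \<le> r" "quadratic_approx \<phi> x (gradient \<phi> x) (hessian \<phi> x) \<delta> 0
     (norm (third_deriv \<phi> x) + norm (gradient \<phi> x))"
proof -
  let ?T = "third_deriv \<phi>"
  define \<eta> where "\<eta> = norm (third_deriv \<phi> x) + norm (gradient \<phi> x)"
  have C2: "C_on 2 (ball x r) \<phi>" using C by (rule C_on_3_imp_2)
  have "isCont ?T x"
    using continuous_on_third_deriv[OF C] r by (simp add: continuous_on_eq_continuous_at)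
  then obtain \<delta>0 where \<delta>0: "\<delta>0 > 0" "\<And>y. dist y x < \<delta>0 \<Longrightarrow> dist (?T y) (?T x) < norm (gradient \<phi> x)"
    using g unfolding continuous_at_eps_delta by (metis zero_less_norm_iff)
  define \<delta> where "\<delta> = min \<delta>0 r"
  have \<eta>: "\<eta> \<ge> 0" by (simp add: \<eta>_def)
  have "\<bar>\<phi> (x + h) - \<phi> x - quad_poly (gradient \<phi> x) (hessian \<phi> x) h\<bar> \<le> \<eta> * norm h ^ 3" if h: "norm h < \<delta>" for h
  proof -
    have "norm h < r" using h by (simp add: \<delta>_def)
    from taylor_order_3[OF C this] obtain t where t: "0 < t" "t < 1"
      "\<phi> (x + h) = \<phi> x + line_deriv1 \<phi> h x + line_deriv2 \<phi> h x / 2 + line_deriv3 \<phi> h (x + t *\<^sub>R h) / 6" by blast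
    have "x + t *\<^sub>R h \<in> ball x \<delta>" using t by (intro line_in_ball[OF h]) auto
    then have "norm (?T (x + t *\<^sub>R h) - ?T x) \<le> norm (gradient \<phi> x)"
      using \<delta>0(2)[of "x + t *\<^sub>R h"] by (simp add: \<delta>_def dist_norm)
    then have "norm (?T (x + t *\<^sub>R h)) \<le> \<eta>"
      using norm_triangle_sub[of "?T (x + t *\<^sub>R h)" "?T x"] by (simp add: \<eta>_def)
    then have "norm (?T (x + t *\<^sub>R h)) * norm h ^ 3 \<le> \<eta> * norm h ^ 3"
      by (intro mult_right_mono) auto
    moreover have "\<phi> (x + h) - \<phi> x - quad_poly (gradient \<phi> x) (hessian \<phi> x) h = line_deriv3 \<phi> h (x + t *\<^sub>R h) / 6"
      by (simp add: t(3) line_deriv1_eq line_deriv2_eq quad_poly_def)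
    ultimately show ?thesis
      using abs_line_deriv3_le[of \<phi> h "x + t *\<^sub>R h"] by simp
  qed
  moreover have "continuous_on (ball x \<delta>) \<phi>"
    using C_on_Suc_imp[of 0 "ball x r" \<phi>] C_on_Suc_imp[of 1 "ball x r" \<phi>] C2
    by (auto simp: numeral_2_eq_2 \<delta>_def intro: continuous_on_subset)
  ultimately have "quadratic_approx \<phi> x (gradient \<phi> x) (hessian \<phi> x) \<delta> 0 \<eta>"
    using \<eta> by (simp add: quadratic_approx_def)
  then show ?thesis using that[of \<delta>] \<delta>0(1) r by (simp add: \<delta>_def \<eta>_def)
qed

section \<open>Pointwise values and the essential supremum\<close>

text \<open>If \<open>f\<close> were larger than its essential supremum at one point, it would be so on a nonempty open
  set, which is not a null set.\<close>

lemma norm_le_Linf_norm: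
  fixes f :: "'a::euclidean_space \<Rightarrow> 'b::real_normed_vector"
  assumes f: "continuous_on (ball x r) f" and y: "y \<in> ball x r"
  shows "ereal (norm (f y)) \<le> Linf_norm (ball x r) f"
proof (rule ccontr)
  define z where "z = Linf_norm (ball x r) f"
  assume "\<not> ereal (norm (f y)) \<le> Linf_norm (ball x r) f"
  then have lt: "z < ereal (norm (f y))" by (simp add: z_def)
  have "isCont f y" using f y by (simp add: continuous_on_eq_continuous_at)
  then have "((\<lambda>w. ereal (norm (f w))) \<longlongrightarrow> ereal (norm (f y))) (nhds y)"
    by (intro tendsto_ereal tendsto_norm) (simp add: isCont_def tendsto_at_iff_tendsto_nhds)
  from order_tendstoD(1)[OF this lt] obtain e
    where e: "e > 0" "\<And>w. dist w y < e \<Longrightarrow> z < ereal (norm (f w))"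
    by (auto simp: eventually_nhds_metric)
  let ?U = "ball y e \<inter> ball x r"
  have "AE w in lebesgue_on (ball x r). ereal (norm (f w)) \<le> z"
    unfolding z_def Linf_norm_def by (rule esssup_AE)
  then have "AE w in lebesgue. w \<in> ball x r \<longrightarrow> ereal (norm (f w)) \<le> z"
    by (simp add: AE_restrict_space_iff)
  then have "AE w in lebesgue. w \<notin> ?U"
    by (rule AE_mp) (use e(2) in \<open>force intro!: AE_I2 simp: dist_commute not_le\<close>)
  then have "negligible ?U"
    by (subst (asm) AE_iff_null_sets[symmetric]) (auto simp: negligible_iff_null_sets)
  moreover have "y \<in> ?U" using y e(1) by simp
  ultimately show False using open_not_negligible[of ?U] by blast
qed

section \<open>The asymptotic expansion\<close>

text \<open>Replacing \<open>\<phi>\<close> by \<open>-\<phi>\<close> when its p-Laplacian at \<open>x\<close> is negative exchanges the two averaging operators,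
  so that only the first one and \<open>L \<ge> 0\<close> have to be considered.\<close>

lemma signed_expansion:
  fixes \<phi> :: "real^'n::finite \<Rightarrow> real" and p r :: real and x :: "real^'n"
  defines "g \<equiv> gradient \<phi> x" and "H \<equiv> hessian \<phi> x" and "D \<equiv> p_laplacian p \<phi> x"
  assumes p: "p > 2" and C: "C_on 2 (ball x r) \<phi>" and r: "r > 0" and g0: "gradient \<phi> x \<noteq> 0"
  obtains \<psi> g' H' where
    "g' \<noteq> 0" "normalized_p_lap p g' H' \<ge> 0" "D \<noteq> 0 \<longrightarrow> normalized_p_lap p g' H' > 0"
    "norm g' = norm g" "norm H' = norm H"
    "\<forall>\<delta> \<eta>2 \<eta>3. quadratic_approx \<phi> x g H \<delta> \<eta>2 \<eta>3 \<longrightarrow> quadratic_approx \<psi> x g' H' \<delta> \<eta>2 \<eta>3"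
    "\<forall>U \<epsilon>. A_well_defined p U \<epsilon> \<phi> x \<longleftrightarrow> A_plus_well_defined p U \<epsilon> \<psi> x"
    "\<forall>\<epsilon>. \<bar>A_op p \<epsilon> \<phi> x - (\<phi> x + \<epsilon>\<^sup>2 * J p D)\<bar>
         = \<bar>A_plus p \<epsilon> \<psi> x - (\<psi> x + \<epsilon>\<^sup>2 * J p (norm g' powr (p - 2) * normalized_p_lap p g' H'))\<bar>"
proof -
  have g: "g \<noteq> 0" using g0 by (simp add: g_def)
  have D: "D = norm g powr (p - 2) * normalized_p_lap p g H"
    unfolding D_def g_def H_def using p_laplacian_eq[OF C _ g0] r by simp
  have pos: "norm g powr (p - 2) > 0" using g by simp
  show ?thesis
  proof (cases "D \<ge> 0")
    case True
    show ?thesis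
    proof (rule that[of g H \<phi>])
      show "normalized_p_lap p g H \<ge> 0" using True pos by (simp add: D zero_le_mult_iff)
      show "D \<noteq> 0 \<longrightarrow> normalized_p_lap p g H > 0" using True pos by (simp add: D zero_le_mult_iff)
    qed (use g True in \<open>auto simp: A_well_defined_def A_op_def D simp flip: D_def\<close>)
  next
    case False
    let ?\<psi> = "\<lambda>y. - \<phi> y"
    have neg: "normalized_p_lap p g H < 0" using False pos by (simp add: D mult_less_0_iff not_le)
    show ?thesis
    proof (rule that[of "- g" "- H" ?\<psi>])
      show "\<forall>\<epsilon>. \<bar>A_op p \<epsilon> \<phi> x - (\<phi> x + \<epsilon>\<^sup>2 * J p D)\<bar>
         = \<bar>A_plus p \<epsilon> ?\<psi> x - (?\<psi> x + \<epsilon>\<^sup>2 * J p (norm (- g) powr (p - 2) * normalized_p_lap p (- g) (- H)))\<bar>"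
      proof
        fix \<epsilon>
        have "J p (norm (- g) powr (p - 2) * normalized_p_lap p (- g) (- H)) = - J p D"
          by (simp add: normalized_p_lap_minus D flip: J_minus)
        moreover have "A_op p \<epsilon> \<phi> x = - A_plus p \<epsilon> ?\<psi> x"
          using False by (simp add: A_op_def A_minus_eq D_def)
        ultimately show "\<bar>A_op p \<epsilon> \<phi> x - (\<phi> x + \<epsilon>\<^sup>2 * J p D)\<bar>
         = \<bar>A_plus p \<epsilon> ?\<psi> x - (?\<psi> x + \<epsilon>\<^sup>2 * J p (norm (- g) powr (p - 2) * normalized_p_lap p (- g) (- H)))\<bar>"
          by simp
      qed
    qed (use g False neg in \<open>auto simp: A_well_defined_def A_minus_well_defined_iff normalized_p_lap_minus
          quadratic_approx_minus simp flip: D_def\<close>)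
  qed
qed

lemma eventually_at_right_0_bounded:
  assumes "\<forall>\<^sub>F \<epsilon> in at_right (0::real). P \<epsilon>" "0 < b"
  shows "\<exists>\<epsilon>'\<in>{0<..<b}. \<forall>\<epsilon>\<in>{0<..<\<epsilon>'}. P \<epsilon>"
proof -
  obtain c where c: "c > 0" "\<And>\<epsilon>. 0 < \<epsilon> \<Longrightarrow> \<epsilon> < c \<Longrightarrow> P \<epsilon>"
    using assms(1) by (auto simp: eventually_at_right_field)
  show ?thesis by (rule bexI[of _ "min (c / 2) (b / 2)"]) (use c assms(2) in auto)
qed

theorem theorem2p1:
  fixes p :: real
  assumes "p > 2"
  shows "\<exists>K1>0. \<exists>K2>0. \<forall>\<epsilon>0 (x :: real^'n::finite) \<phi>.
    0 < \<epsilon>0 \<and> \<epsilon>0 < 1 \<and> C_on 2 (ball x \<epsilon>0) \<phi> \<and> gradient \<phi> x \<noteq> 0 \<longrightarrow>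
      (\<exists>\<epsilon>'\<in>{0<..<\<epsilon>0}. \<forall>\<epsilon>\<in>{0<..<\<epsilon>'}. A_well_defined p (ball x \<epsilon>0) \<epsilon> \<phi> x)
    \<and> (p_laplacian p \<phi> x \<noteq> 0 \<longrightarrow>
        (\<lambda>\<epsilon>. A_op p \<epsilon> \<phi> x - (\<phi> x + \<epsilon>\<^sup>2 * J p (p_laplacian p \<phi> x))) \<in> o[at_right 0](\<lambda>\<epsilon>. \<epsilon>\<^sup>2))
    \<and> (C_on 3 (ball x \<epsilon>0) \<phi> \<longrightarrow>
        (\<exists>\<epsilon>'\<in>{0<..<\<epsilon>0}. \<exists>E :: real \<Rightarrow> real. \<forall>\<epsilon>\<in>{0<..<\<epsilon>'}.
            A_well_defined p (ball x \<epsilon>0) \<epsilon> \<phi> x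
          \<and> A_op p \<epsilon> \<phi> x = \<phi> x + \<epsilon>\<^sup>2 * J p (p_laplacian p \<phi> x) + \<epsilon>\<^sup>2 * E \<epsilon>
          \<and> ereal \<bar>E \<epsilon>\<bar> \<le>
              ereal K1 * Linf_norm (ball x \<epsilon>') (hessian \<phi>) * ereal (\<epsilon> powr (2 * (p - 2) / p))
            + ereal K2 * (Linf_norm (ball x \<epsilon>') (gradient \<phi>)
                          + Linf_norm (ball x \<epsilon>') (third_deriv \<phi>)
                          + ereal ((norm (hessian \<phi> x))\<^sup>2 / norm (gradient \<phi> x)))
                * ereal (\<epsilon> powr (2 / (3 * p - 4)))))"
proof (rule exI[of _ 1], intro conjI exI[of _ "2 + gamma_const p CARD('n) ^ 3"] allI impI)
  note p = \<open>p > 2\<close>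
  define \<gamma> where "\<gamma> = gamma_const p CARD('n)"
  have \<gamma>: "\<gamma> \<ge> 1" using gamma_const_ge_1[OF p] by (simp add: \<gamma>_def)
  show "(0::real) < 1" by simp
  show "0 < 2 + gamma_const p CARD('n) ^ 3"
    using \<gamma> zero_le_power[of \<gamma> 3] unfolding \<gamma>_def[symmetric] by linarith
  fix \<epsilon>0 :: real and x :: "real^'n" and \<phi> :: "real^'n \<Rightarrow> real"
  assume "0 < \<epsilon>0 \<and> \<epsilon>0 < 1 \<and> C_on 2 (ball x \<epsilon>0) \<phi> \<and> gradient \<phi> x \<noteq> 0"
  then have \<epsilon>0: "0 < \<epsilon>0" and C2: "C_on 2 (ball x \<epsilon>0) \<phi>" and g: "gradient \<phi> x \<noteq> 0" by auto
  define G where "G = norm (gradient \<phi> x)"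
  define h where "h = norm (hessian \<phi> x)"
  obtain \<psi> g' H' where s: "g' \<noteq> 0" "normalized_p_lap p g' H' \<ge> 0"
    "p_laplacian p \<phi> x \<noteq> 0 \<longrightarrow> normalized_p_lap p g' H' > 0"
    "norm g' = norm (gradient \<phi> x)" "norm H' = norm (hessian \<phi> x)"
    "\<forall>\<delta> \<eta>2 \<eta>3. quadratic_approx \<phi> x (gradient \<phi> x) (hessian \<phi> x) \<delta> \<eta>2 \<eta>3 \<longrightarrow> quadratic_approx \<psi> x g' H' \<delta> \<eta>2 \<eta>3"
    "\<forall>U \<epsilon>. A_well_defined p U \<epsilon> \<phi> x \<longleftrightarrow> A_plus_well_defined p U \<epsilon> \<psi> x"
    "\<forall>\<epsilon>. \<bar>A_op p \<epsilon> \<phi> x - (\<phi> x + \<epsilon>\<^sup>2 * J p (p_laplacian p \<phi> x))\<bar>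
         = \<bar>A_plus p \<epsilon> \<psi> x - (\<psi> x + \<epsilon>\<^sup>2 * J p (norm g' powr (p - 2) * normalized_p_lap p g' H'))\<bar>"
    using signed_expansion[OF p C2 \<epsilon>0 g] .
  note \<psi> = s(1,2) s(3)[rule_format] s(4,5)[folded G_def h_def] s(6-8)[rule_format]
  have wd: "A_well_defined p (ball x \<epsilon>0) \<epsilon> \<phi> x"
    if "quadratic_approx \<psi> x g' H' \<delta> \<eta>2 \<eta>3" "\<delta> \<le> \<epsilon>0" "0 < \<epsilon>" "\<epsilon> < 1" "\<gamma> * m_eps p \<epsilon> < \<delta>" for \<delta> \<eta>2 \<eta>3 \<epsilon>
    unfolding \<psi>(7) using that subset_ball[OF that(2), of x]
    by (intro A_plus_well_defined[OF p \<psi>(1) that(1)] \<psi>(2)) (auto simp: \<gamma>_def)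
  show "\<exists>\<epsilon>'\<in>{0<..<\<epsilon>0}. \<forall>\<epsilon>\<in>{0<..<\<epsilon>'}. A_well_defined p (ball x \<epsilon>0) \<epsilon> \<phi> x"
  proof -
    obtain \<delta> where \<delta>: "0 < \<delta>" "\<delta> \<le> \<epsilon>0" "quadratic_approx \<phi> x (gradient \<phi> x) (hessian \<phi> x) \<delta> 1 0"
      using quadratic_approx_of_C2[OF C2 \<epsilon>0 zero_less_one] .
    have "\<forall>\<^sub>F \<epsilon> in at_right 0. A_well_defined p (ball x \<epsilon>0) \<epsilon> \<phi> x"
      using eventually_eps_admissible[OF p \<delta>(1), of "CARD('n)"]
      by eventually_elim (use wd[OF \<psi>(6)[OF \<delta>(3)] \<delta>(2)] in \<open>auto simp: \<gamma>_def\<close>)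
    from eventually_at_right_0_bounded[OF this \<epsilon>0] show ?thesis .
  qed
  show "(\<lambda>\<epsilon>. A_op p \<epsilon> \<phi> x - (\<phi> x + \<epsilon>\<^sup>2 * J p (p_laplacian p \<phi> x))) \<in> o[at_right 0](\<lambda>\<epsilon>. \<epsilon>\<^sup>2)"
    if "p_laplacian p \<phi> x \<noteq> 0"
  proof -
    have "(\<lambda>\<epsilon>. A_plus p \<epsilon> \<psi> x - (\<psi> x + \<epsilon>\<^sup>2 * J p (norm g' powr (p - 2) * normalized_p_lap p g' H')))
       \<in> o[at_right 0](\<lambda>\<epsilon>. \<epsilon>\<^sup>2)"
    proof (rule A_plus_asymptotics[OF p \<psi>(1) \<psi>(3)[OF that]])
      fix \<eta> :: real assume "\<eta> > 0"
      then show "\<exists>\<delta>>0. quadratic_approx \<psi> x g' H' \<delta> \<eta> 0"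
        using quadratic_approx_of_C2[OF C2 \<epsilon>0] \<psi>(6) by metis
    qed
    then show ?thesis
      unfolding smallo_def by (simp add: \<psi>(8))
  qed
  assume C3: "C_on 3 (ball x \<epsilon>0) \<phi>"
  define T where "T = norm (third_deriv \<phi> x)"
  obtain \<delta> where \<delta>: "0 < \<delta>" "\<delta> \<le> \<epsilon>0" "quadratic_approx \<phi> x (gradient \<phi> x) (hessian \<phi> x) \<delta> 0 (T + G)"
    using quadratic_approx_of_C3[OF C3 \<epsilon>0 g] unfolding T_def G_def .
  have "\<forall>\<^sub>F \<epsilon> in at_right 0. normalized_p_lap p g' H' > 0 \<longrightarrow> normalized_p_lap p g' H' / norm g' \<in> {m_eps p \<epsilon>..M_eps p \<epsilon>}"
    using eventually_in_c_range[OF p, of "normalized_p_lap p g' H' / norm g'"] \<psi>(1)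
    by (cases "normalized_p_lap p g' H' > 0") auto
  with eventually_eps_admissible[OF p \<delta>(1), of "CARD('n)"]
  have "\<forall>\<^sub>F \<epsilon> in at_right 0. (0 < \<epsilon> \<and> \<epsilon> < 1 \<and> gamma_const p CARD('n) * m_eps p \<epsilon> < \<delta>) \<and>
    (normalized_p_lap p g' H' > 0 \<longrightarrow> normalized_p_lap p g' H' / norm g' \<in> {m_eps p \<epsilon>..M_eps p \<epsilon>})"
    by (rule eventually_conj)
  from eventually_at_right_0_bounded[OF this \<epsilon>0] obtain \<epsilon>' where \<epsilon>': "\<epsilon>' \<in> {0<..<\<epsilon>0}"
    and adm': "\<forall>\<epsilon>\<in>{0<..<\<epsilon>'}. (0 < \<epsilon> \<and> \<epsilon> < 1 \<and> gamma_const p CARD('n) * m_eps p \<epsilon> < \<delta>) \<and>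
      (normalized_p_lap p g' H' > 0 \<longrightarrow> normalized_p_lap p g' H' / norm g' \<in> {m_eps p \<epsilon>..M_eps p \<epsilon>})"
    by (rule bexE)
  have adm: "0 < \<epsilon>" "\<epsilon> < 1" "gamma_const p CARD('n) * m_eps p \<epsilon> < \<delta>"
      "normalized_p_lap p g' H' > 0 \<Longrightarrow> normalized_p_lap p g' H' / norm g' \<in> {m_eps p \<epsilon>..M_eps p \<epsilon>}"
    if "\<epsilon> \<in> {0<..<\<epsilon>'}" for \<epsilon>
    using adm'[rule_format, OF that] by simp_all
  define E where "E \<epsilon> = (A_op p \<epsilon> \<phi> x - (\<phi> x + \<epsilon>\<^sup>2 * J p (p_laplacian p \<phi> x))) / \<epsilon>\<^sup>2" for \<epsilon>
  \<comment> \<open>The values at the centre of the ball are all that is needed of the three norms.\<close>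
  have sub: "ball x \<epsilon>' \<subseteq> ball x \<epsilon>0" using \<epsilon>' by (intro subset_ball) auto
  have x: "x \<in> ball x \<epsilon>'" using \<epsilon>' by simp
  have nG: "ereal G \<le> Linf_norm (ball x \<epsilon>') (gradient \<phi>)"
    unfolding G_def by (rule norm_le_Linf_norm[OF continuous_on_subset[OF continuous_on_gradient[OF C2] sub] x])
  have nH: "ereal h \<le> Linf_norm (ball x \<epsilon>') (hessian \<phi>)"
    unfolding h_def by (rule norm_le_Linf_norm[OF continuous_on_subset[OF continuous_on_hessian[OF C2] sub] x])
  have nT: "ereal T \<le> Linf_norm (ball x \<epsilon>') (third_deriv \<phi>)"
    unfolding T_def by (rule norm_le_Linf_norm[OF continuous_on_subset[OF continuous_on_third_deriv[OF C3] sub] x])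
  have G: "G > 0" using g by (simp add: G_def)
  have "A_well_defined p (ball x \<epsilon>0) \<epsilon> \<phi> x
          \<and> A_op p \<epsilon> \<phi> x = \<phi> x + \<epsilon>\<^sup>2 * J p (p_laplacian p \<phi> x) + \<epsilon>\<^sup>2 * E \<epsilon>
          \<and> ereal \<bar>E \<epsilon>\<bar> \<le>
              ereal 1 * Linf_norm (ball x \<epsilon>') (hessian \<phi>) * ereal (\<epsilon> powr (2 * (p - 2) / p))
            + ereal (2 + gamma_const p CARD('n) ^ 3) * (Linf_norm (ball x \<epsilon>') (gradient \<phi>)
                          + Linf_norm (ball x \<epsilon>') (third_deriv \<phi>)
                          + ereal ((norm (hessian \<phi> x))\<^sup>2 / norm (gradient \<phi> x)))
                * ereal (\<epsilon> powr (2 / (3 * p - 4)))" if \<epsilon>: "\<epsilon> \<in> {0<..<\<epsilon>'}" for \<epsilon>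
  proof (intro conjI)
    define \<theta> where "\<theta> = \<epsilon> powr (2 * (p - 2) / p)"
    define \<tau> where "\<tau> = \<epsilon> powr (2 / (3 * p - 4))"
    have \<theta>\<tau>: "\<theta> \<ge> 0" "\<tau> \<ge> 0" by (simp_all add: \<theta>_def \<tau>_def)
    have T\<psi>: "quadratic_approx \<psi> x g' H' \<delta> 0 (T + G)" by (rule \<psi>(6)[OF \<delta>(3)])
    show "A_well_defined p (ball x \<epsilon>0) \<epsilon> \<phi> x"
      using wd[OF T\<psi> \<delta>(2)] adm(1-3)[OF \<epsilon>] by (simp add: \<gamma>_def)
    show "A_op p \<epsilon> \<phi> x = \<phi> x + \<epsilon>\<^sup>2 * J p (p_laplacian p \<phi> x) + \<epsilon>\<^sup>2 * E \<epsilon>"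
      using adm(1)[OF \<epsilon>] by (simp add: E_def)
    have "\<epsilon>\<^sup>2 * \<bar>E \<epsilon>\<bar> = \<bar>A_op p \<epsilon> \<phi> x - (\<phi> x + \<epsilon>\<^sup>2 * J p (p_laplacian p \<phi> x))\<bar>"
      using adm(1)[OF \<epsilon>] by (simp add: E_def)
    also have "\<dots> \<le> \<epsilon>\<^sup>2 * (norm g' * \<tau> + body_error p CARD('n) g' H' 0 (T + G) \<epsilon>)"
      unfolding \<psi>(8) \<tau>_def by (rule A_plus_rate[OF p \<psi>(1) T\<psi> adm(1-3)[OF \<epsilon>] \<psi>(2) adm(4)[OF \<epsilon>]])
    finally have "\<bar>E \<epsilon>\<bar> \<le> norm g' * \<tau> + body_error p CARD('n) g' H' 0 (T + G) \<epsilon>"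
      using adm(1)[OF \<epsilon>] by (simp add: mult_le_cancel_left_pos)
    also have "\<dots> = (h / 2) * \<theta> + ((1 + \<gamma> ^ 3) * (h\<^sup>2 / G + (T + G)) + G) * \<tau>"
      by (simp add: body_error_def \<psi>(4,5) \<theta>_def \<tau>_def \<gamma>_def algebra_simps)
    \<comment> \<open>The factor \<open>1 + \<gamma>\<^sup>3\<close> is that of the cubic errors, with \<open>G\<close> as slack in the bound for the
      third derivatives; the further \<open>G\<close> comes from the missing minimiser when \<open>L = 0\<close>.\<close>
    also have "\<dots> \<le> 1 * h * \<theta> + (2 + \<gamma> ^ 3) * (G + T + h\<^sup>2 / G) * \<tau>"
    proof (intro add_mono mult_right_mono \<theta>\<tau>)
      have "(2 + c) * (G + T + Z) = (1 + c) * (Z + (T + G)) + G + (T + Z)" for c Z :: real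
        by (simp add: algebra_simps)
      from this[of "\<gamma> ^ 3" "h\<^sup>2 / G"]
      have "(2 + \<gamma> ^ 3) * (G + T + h\<^sup>2 / G) = (1 + \<gamma> ^ 3) * (h\<^sup>2 / G + (T + G)) + G + (T + h\<^sup>2 / G)" .
      moreover have "T + h\<^sup>2 / G \<ge> 0" using G by (simp add: T_def)
      ultimately show "(1 + \<gamma> ^ 3) * (h\<^sup>2 / G + (T + G)) + G \<le> (2 + \<gamma> ^ 3) * (G + T + h\<^sup>2 / G)" by linarith
    qed (simp add: h_def)
    finally have "ereal \<bar>E \<epsilon>\<bar> \<le> ereal (1 * h * \<theta> + (2 + \<gamma> ^ 3) * (G + T + h\<^sup>2 / G) * \<tau>)" by simp
    also have "\<dots> = ereal 1 * ereal h * ereal \<theta> + ereal (2 + \<gamma> ^ 3) * (ereal G + ereal T + ereal (h\<^sup>2 / G)) * ereal \<tau>"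
      by simp
    also have "\<dots> \<le> ereal 1 * Linf_norm (ball x \<epsilon>') (hessian \<phi>) * ereal \<theta>
        + ereal (2 + \<gamma> ^ 3) * (Linf_norm (ball x \<epsilon>') (gradient \<phi>) + Linf_norm (ball x \<epsilon>') (third_deriv \<phi>)
            + ereal (h\<^sup>2 / G)) * ereal \<tau>"
      using \<theta>\<tau> \<gamma> by (intro add_mono ereal_mult_right_mono ereal_mult_left_mono nG nH nT order_refl) auto
    finally show "ereal \<bar>E \<epsilon>\<bar> \<le>
              ereal 1 * Linf_norm (ball x \<epsilon>') (hessian \<phi>) * ereal (\<epsilon> powr (2 * (p - 2) / p))
            + ereal (2 + gamma_const p CARD('n) ^ 3) * (Linf_norm (ball x \<epsilon>') (gradient \<phi>)
                          + Linf_norm (ball x \<epsilon>') (third_deriv \<phi>)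
                          + ereal ((norm (hessian \<phi> x))\<^sup>2 / norm (gradient \<phi> x)))
                * ereal (\<epsilon> powr (2 / (3 * p - 4)))"
      by (simp only: \<theta>_def \<tau>_def \<gamma>_def h_def G_def)
  qed
  then show "\<exists>\<epsilon>'\<in>{0<..<\<epsilon>0}. \<exists>E :: real \<Rightarrow> real. \<forall>\<epsilon>\<in>{0<..<\<epsilon>'}.
            A_well_defined p (ball x \<epsilon>0) \<epsilon> \<phi> x
          \<and> A_op p \<epsilon> \<phi> x = \<phi> x + \<epsilon>\<^sup>2 * J p (p_laplacian p \<phi> x) + \<epsilon>\<^sup>2 * E \<epsilon>
          \<and> ereal \<bar>E \<epsilon>\<bar> \<le>
              ereal 1 * Linf_norm (ball x \<epsilon>') (hessian \<phi>) * ereal (\<epsilon> powr (2 * (p - 2) / p))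
            + ereal (2 + gamma_const p CARD('n) ^ 3) * (Linf_norm (ball x \<epsilon>') (gradient \<phi>)
                          + Linf_norm (ball x \<epsilon>') (third_deriv \<phi>)
                          + ereal ((norm (hessian \<phi> x))\<^sup>2 / norm (gradient \<phi> x)))
                * ereal (\<epsilon> powr (2 / (3 * p - 4)))"
    using \<epsilon>' by blast
qed

end
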